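(* Let $\mathcal G$ be a compact, connected, finite metric graph with vertex set $\mathsf V$, edge set $\mathsf E$ and total length $|\mathcal G|$. Then \[ \frac{|\mathcal G|^3}{12\,|\mathsf E|^2}\ \le\ T(\mathcal G;\mathsf V_{\mathrm D})\ \le\ \frac{|\mathcal G|^3}{3}\qquad\text{for all }\emptyset\neq\mathsf V_{\mathrm D}\subset\mathsf V . \]
   Context: A compact, connected, finite metric graph consists of finitely many edges $\mathsf e\simeq[0,\ell_{\mathsf e}]$, $0<\ell_{\mathsf e}<\infty$, glued at their endpoints (vertices) to form a connected space; $|\mathcal G|=\sum_{\mathsf e\in\mathsf E}\ell_{\mathsf e}$ and $|\mathsf E|$ is the number of edges. The torsion function $v$ with respect to $\mathsf V_{\mathrm D}$ is the unique function that is continuous on $\mathcal G$, in $H^2$ on each edge, with $-v_{\mathsf e}''=1$ on each edge, $v=0$ on $\mathsf V_{\mathrm D}$, and sum of normal derivatives over all incident edges equal to $0$ at each vertex of $\mathsf V\setminus\mathsf V_{\mathrm D}$. The torsional rigidity is $T(\mathcal G;\mathsf V_{\mathrm D})=\int_{\mathcal G}v\,dx$. *)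

theory Defs
  imports "HOL-Analysis.Analysis" "Graph_Theory.Digraph"
begin

text \<open>
  The combinatorial part of a metric graph is a finite directed multigraph, loops and parallel
  edges allowed. The direction of an arc \<open>e\<close> only fixes the parametrization of that edge by
  \<open>[0, len e]\<close>: the parameter \<open>0\<close> is the tail, \<open>len e\<close> the head.
\<close>

datatype ('v, 'e) mg_point = Vertex 'v | Inner 'e real

definition edge_point ::
  "('v, 'e) pre_digraph \<Rightarrow> ('e \<Rightarrow> real) \<Rightarrow> 'e \<Rightarrow> real \<Rightarrow> ('v, 'e) mg_point" where
  "edge_point G len e x =
     (if x = 0 then Vertex (tail G e) else if x = len e then Vertex (head G e) else Inner e x)"

definition mg_points :: "('v, 'e) pre_digraph \<Rightarrow> ('e \<Rightarrow> real) \<Rightarrow> ('v, 'e) mg_point set" where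
  "mg_points G len = Vertex ` verts G \<union> (\<Union>e\<in>arcs G. edge_point G len e ` {0..len e})"

text \<open>The gluing (quotient) topology: the finest one making all edge parametrizations continuous.\<close>

definition mg_topology :: "('v, 'e) pre_digraph \<Rightarrow> ('e \<Rightarrow> real) \<Rightarrow> ('v, 'e) mg_point topology" where
  "mg_topology G len = topology (\<lambda>U. U \<subseteq> mg_points G len \<and>
     (\<forall>e\<in>arcs G. openin (top_of_set {0..len e}) {x \<in> {0..len e}. edge_point G len e x \<in> U}))"

lemma openin_mg_topology:
  "openin (mg_topology G len) U \<longleftrightarrow> U \<subseteq> mg_points G len \<and>
     (\<forall>e\<in>arcs G. openin (top_of_set {0..len e}) {x \<in> {0..len e}. edge_point G len e x \<in> U})"
proof -
  have "istopology (\<lambda>U. U \<subseteq> mg_points G len \<and>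
     (\<forall>e\<in>arcs G. openin (top_of_set {0..len e}) {x \<in> {0..len e}. edge_point G len e x \<in> U}))"
    (is "istopology ?P")
    unfolding istopology_def
  proof (intro conjI allI impI)
    fix S T assume S: "?P S" and T: "?P T"
    show "S \<inter> T \<subseteq> mg_points G len" using S by blast
    show "\<forall>e\<in>arcs G. openin (top_of_set {0..len e})
            {x \<in> {0..len e}. edge_point G len e x \<in> S \<inter> T}"
    proof
      fix e assume e: "e \<in> arcs G"
      have "{x \<in> {0..len e}. edge_point G len e x \<in> S \<inter> T} =
        {x \<in> {0..len e}. edge_point G len e x \<in> S} \<inter> {x \<in> {0..len e}. edge_point G len e x \<in> T}"
        by blast
      then show "openin (top_of_set {0..len e}) {x \<in> {0..len e}. edge_point G len e x \<in> S \<inter> T}"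
        using S T e by (simp only: openin_Int)
    qed
  next
    fix K assume K: "\<forall>S\<in>K. ?P S"
    show "\<Union>K \<subseteq> mg_points G len" using K by blast
    show "\<forall>e\<in>arcs G. openin (top_of_set {0..len e})
            {x \<in> {0..len e}. edge_point G len e x \<in> \<Union>K}"
    proof
      fix e assume e: "e \<in> arcs G"
      have "{x \<in> {0..len e}. edge_point G len e x \<in> \<Union>K} =
        (\<Union>S\<in>K. {x \<in> {0..len e}. edge_point G len e x \<in> S})"
        by blast
      moreover have "openin (top_of_set {0..len e})
          (\<Union>S\<in>K. {x \<in> {0..len e}. edge_point G len e x \<in> S})"
        using K e by (intro openin_Union) blast
      ultimately show "openin (top_of_set {0..len e}) {x \<in> {0..len e}. edge_point G len e x \<in> \<Union>K}"
        by simp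
    qed
  qed
  then show ?thesis
    unfolding mg_topology_def by (simp add: topology_inverse')
qed

locale metric_graph = fin_digraph G
  for G :: "('v, 'e) pre_digraph" +
  fixes len :: "'e \<Rightarrow> real"
  assumes arcs_nonempty: "arcs G \<noteq> {}"
    and len_pos: "e \<in> arcs G \<Longrightarrow> 0 < len e"
    and connected_mg: "connected_space (mg_topology G len)"

definition total_length :: "('v, 'e) pre_digraph \<Rightarrow> ('e \<Rightarrow> real) \<Rightarrow> real" where
  "total_length G len = (\<Sum>e\<in>arcs G. len e)"

definition on_edge ::
  "('v, 'e) pre_digraph \<Rightarrow> ('e \<Rightarrow> real) \<Rightarrow> (('v, 'e) mg_point \<Rightarrow> real) \<Rightarrow> 'e \<Rightarrow> real \<Rightarrow> real" where
  "on_edge G len v e x = v (edge_point G len e x)"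

text \<open>
  Sobolev functions on the interval \<open>(0, l)\<close>. As usual in dimension one, weak derivatives are
  tested with continuously differentiable functions of compact support in \<open>(0, l)\<close>.
\<close>

definition L2_on :: "real \<Rightarrow> (real \<Rightarrow> real) \<Rightarrow> bool" where
  "L2_on l f \<longleftrightarrow> set_borel_measurable lborel {0<..<l} f \<and>
     set_integrable lborel {0<..<l} (\<lambda>x. (f x)\<^sup>2)"

definition weak_deriv :: "real \<Rightarrow> (real \<Rightarrow> real) \<Rightarrow> (real \<Rightarrow> real) \<Rightarrow> bool" where
  "weak_deriv l f g \<longleftrightarrow>
     (\<forall>\<phi> \<phi>'. (\<forall>x. (\<phi> has_real_derivative \<phi>' x) (at x)) \<and> continuous_on UNIV \<phi>' \<and>
        (\<exists>a b. 0 < a \<and> b < l \<and> (\<forall>x. x \<notin> {a..b} \<longrightarrow> \<phi> x = 0)) \<longrightarrow>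
        (LINT x:{0<..<l}|lborel. f x * \<phi>' x) = - (LINT x:{0<..<l}|lborel. g x * \<phi> x))"

text \<open>\<open>H2_with l f h\<close>: the function \<open>f\<close> is in \<open>H\<^sup>2(0, l)\<close>, with second derivative \<open>h\<close>.\<close>

definition H2_with :: "real \<Rightarrow> (real \<Rightarrow> real) \<Rightarrow> (real \<Rightarrow> real) \<Rightarrow> bool" where
  "H2_with l f h \<longleftrightarrow>
     (\<exists>g. L2_on l f \<and> L2_on l g \<and> L2_on l h \<and> weak_deriv l f g \<and> weak_deriv l g h)"

text \<open>
  Sum of the outer normal derivatives at the vertex \<open>w\<close>; a loop at \<open>w\<close> contributes at both of its
  ends. A continuous function on \<open>[0, l]\<close> that is in \<open>H\<^sup>2(0, l)\<close> is continuously differentiable up to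
  the end points, so that the one-sided derivatives exist where this is used.
\<close>

definition normal_deriv_sum ::
  "('v, 'e) pre_digraph \<Rightarrow> ('e \<Rightarrow> real) \<Rightarrow> (('v, 'e) mg_point \<Rightarrow> real) \<Rightarrow> 'v \<Rightarrow> real" where
  "normal_deriv_sum G len v w =
     (\<Sum>e | e \<in> arcs G \<and> tail G e = w.
        - vector_derivative (on_edge G len v e) (at 0 within {0..len e})) +
     (\<Sum>e | e \<in> arcs G \<and> head G e = w.
        vector_derivative (on_edge G len v e) (at (len e) within {0..len e}))"

text \<open>
  Values off the graph are irrelevant; fixing them by \<open>extensional\<close> makes the torsion function
  unique as a HOL function.
\<close>

definition is_torsion_function ::
  "('v, 'e) pre_digraph \<Rightarrow> ('e \<Rightarrow> real) \<Rightarrow> 'v set \<Rightarrow> (('v, 'e) mg_point \<Rightarrow> real) \<Rightarrow> bool" where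
  "is_torsion_function G len VD v \<longleftrightarrow>
     v \<in> extensional (mg_points G len) \<and>
     continuous_map (mg_topology G len) euclideanreal v \<and>
     (\<forall>e\<in>arcs G. \<exists>h. H2_with (len e) (on_edge G len v e) h \<and>
        (AE x in lborel. x \<in> {0<..<len e} \<longrightarrow> - h x = 1)) \<and>
     (\<forall>w\<in>VD. v (Vertex w) = 0) \<and>
     (\<forall>w\<in>verts G - VD. normal_deriv_sum G len v w = 0)"

definition torsion_function ::
  "('v, 'e) pre_digraph \<Rightarrow> ('e \<Rightarrow> real) \<Rightarrow> 'v set \<Rightarrow> ('v, 'e) mg_point \<Rightarrow> real" where
  "torsion_function G len VD = (THE v. is_torsion_function G len VD v)"

definition mg_integral ::
  "('v, 'e) pre_digraph \<Rightarrow> ('e \<Rightarrow> real) \<Rightarrow> (('v, 'e) mg_point \<Rightarrow> real) \<Rightarrow> real" where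
  "mg_integral G len v = (\<Sum>e\<in>arcs G. LINT x:{0..len e}|lborel. on_edge G len v e x)"

definition torsional_rigidity ::
  "('v, 'e) pre_digraph \<Rightarrow> ('e \<Rightarrow> real) \<Rightarrow> 'v set \<Rightarrow> real" where
  "torsional_rigidity G len VD = mg_integral G len (torsion_function G len VD)"

end

(*
  On an edge e the torsion function is the sum of the affine interpolation of its vertex values and
  of x (len e - x) / 2. The Kirchhoff conditions turn into a discrete Poisson equation for the vertex
  values u, and the torsional rigidity is the sum of u w * half_length w over the vertices w plus the
  sum of (len e)^3 / 12 over the edges e. By the minimum principle u >= 0, so the lower bound is the
  power mean inequality. For the upper bound, Thomson's principle bounds the rigidity by the energy of
  any flow on the graph whose divergence is 1 away from VD. Cut the edges outside a spanning forest
  rooted at VD at their midpoints and let the flow run along the forest: at a point that has the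
  length q behind it, its value is q, and the integral of q^2 is at most |G|^3 / 3 because
  a^3 + b^3 <= (a + b)^3 at branch points.
*)

theory Submission
  imports Defs "Jordan_Normal_Form.Determinant"
begin

section \<open>Sums of cubes and linear systems\<close>

text \<open>The rigidity is read off a definite description over weak solutions, so existence,
  uniqueness and regularity come before any estimate. Regularity is the analytic obstacle: on an
  edge the data are a continuous function and weak derivatives known only almost everywhere.
  Subtracting the explicit profile with the same end values leaves a continuous function with zero
  end values and vanishing weak second derivative; a maximum argument shows that it is zero. From
  there on everything is finite. Flows are finite as well: a flow whose divergence is 1 inside an
  edge is affine there with slope of modulus 1, so its midpoint value \<open>c e\<close> determines
  it and its energy is \<open>len e * (c e)\<^sup>2 + len e ^ 3 / 12\<close>. The last term also
  occurs in the rigidity, which is why Thomson's principle is only needed for the midpoint values.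
  The constant 12 comes from the integral of x * (l - x) / 2 over an interval of length l, the
  constant 3 from the integral of q^2.\<close>

lemma square_linear_system_solvable:
  fixes A :: "'a \<Rightarrow> 'a \<Rightarrow> real"
  assumes fin: "finite S"
    and inj: "\<And>u. (\<And>i. i \<in> S \<Longrightarrow> (\<Sum>j\<in>S. A i j * u j) = 0) \<Longrightarrow> \<forall>j\<in>S. u j = 0"
  shows "\<exists>u. \<forall>i\<in>S. (\<Sum>j\<in>S. A i j * u j) = b i"
proof -
  define n where "n = card S"
  obtain f where f: "bij_betw f {0..<n} S"
    using ex_bij_betw_nat_finite[OF fin] n_def by blast
  define g where "g = the_inv_into {0..<n} f"
  have gf: "g (f i) = i" if "i < n" for i
    using f that unfolding g_def bij_betw_def by (simp add: the_inv_into_f_f)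
  have fS: "f i \<in> S" if "i < n" for i
    using f that by (auto simp: bij_betw_def)
  have surj: "\<exists>k<n. s = f k" if "s \<in> S" for s
    using f that by (auto simp: bij_betw_def)
  have sumS: "(\<Sum>j\<in>S. h j) = (\<Sum>k\<in>{0..<n}. h (f k))" for h :: "'a \<Rightarrow> real"
    using sum.reindex_bij_betw[OF f] by metis
  define M where "M = mat n n (\<lambda>(i, j). A (f i) (f j))"
  have M: "M \<in> carrier_mat n n" by (simp add: M_def)
  have mult: "vec_index (M *\<^sub>v x) i = (\<Sum>j\<in>S. A (f i) j * vec_index x (g j))"
    if "x \<in> carrier_vec n" "i < n" for x i
    using that by (auto simp: M_def scalar_prod_def sumS gf intro!: sum.cong)
  \<comment> \<open>Injectivity implies surjectivity in finite dimension: a kernel vector of the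
    matrix would contradict \<open>inj\<close>, so an inverse exists and solves the system for every
    right-hand side.\<close>
  have "Determinant.det M \<noteq> 0"
  proof
    assume "Determinant.det M = 0"
    then obtain x where x: "x \<in> carrier_vec n" "x \<noteq> 0\<^sub>v n" "M *\<^sub>v x = 0\<^sub>v n"
      using det_0_iff_vec_prod_zero_field[OF M] by blast
    have "\<forall>j\<in>S. vec_index x (g j) = 0"
    proof (rule inj)
      fix i assume "i \<in> S"
      then obtain k where k: "k < n" "i = f k" using surj by blast
      show "(\<Sum>j\<in>S. A i j * vec_index x (g j)) = 0"
        using mult[OF x(1) k(1)] x(3) k by simp
    qed
    then have "vec_index x k = 0" if "k < n" for k
      using fS[OF that] gf[OF that] by metis
    then have "x = 0\<^sub>v n" using x(1) by (intro eq_vecI) auto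
    then show False using x(2) by contradiction
  qed
  from det_non_zero_imp_unit[OF M this, of "()"]
  obtain B where B: "B \<in> carrier_mat n n" "M * B = 1\<^sub>m n"
    unfolding Units_def ring_mat_def by auto
  define c where "c = vec n (\<lambda>k. b (f k))"
  define x where "x = B *\<^sub>v c"
  have c: "c \<in> carrier_vec n" by (simp add: c_def)
  have x: "x \<in> carrier_vec n" using B(1) c by (simp add: x_def)
  have Mx: "M *\<^sub>v x = c"
    using assoc_mult_mat_vec[OF M B(1) c] B(2) c by (simp add: x_def)
  show ?thesis
  proof (intro exI ballI)
    fix i assume "i \<in> S"
    then obtain k where k: "k < n" "i = f k" using surj by blast
    show "(\<Sum>j\<in>S. A i j * vec_index x (g j)) = b i"
      using mult[OF x k(1)] k by (simp add: Mx c_def)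
  qed
qed

lemma cube_superadditive:
  fixes a b :: real
  assumes "0 \<le> a" "0 \<le> b"
  shows "a ^ 3 + b ^ 3 \<le> (a + b) ^ 3"
proof -
  have "(a + b) ^ 3 = a ^ 3 + b ^ 3 + 3 * a * b * (a + b)"
    by (simp add: power3_eq_cube algebra_simps)
  then show ?thesis using assms by simp
qed

lemma sum_cubes_le_cube_sum:
  fixes f :: "'a \<Rightarrow> real"
  assumes "\<And>i. i \<in> I \<Longrightarrow> 0 \<le> f i"
  shows "(\<Sum>i\<in>I. f i ^ 3) \<le> (\<Sum>i\<in>I. f i) ^ 3"
  using assms
proof (induction I rule: infinite_finite_induct)
  case (insert x F)
  have "(\<Sum>i\<in>insert x F. f i ^ 3) \<le> f x ^ 3 + (\<Sum>i\<in>F. f i) ^ 3"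
    using insert by simp
  also have "\<dots> \<le> (f x + (\<Sum>i\<in>F. f i)) ^ 3"
    using insert by (intro cube_superadditive sum_nonneg) auto
  finally show ?case using insert by simp
qed auto

lemma cube_sum_le_card_sq_sum_cubes:
  fixes f :: "'a \<Rightarrow> real"
  assumes "finite I" "\<And>i. i \<in> I \<Longrightarrow> 0 \<le> f i"
  shows "(\<Sum>i\<in>I. f i) ^ 3 \<le> (real (card I))\<^sup>2 * (\<Sum>i\<in>I. f i ^ 3)"
proof (cases "I = {}")
  case False
  define n where "n = real (card I)"
  define m where "m = (\<Sum>i\<in>I. f i) / n"
  have n: "n > 0" using False assms(1) by (simp add: n_def card_gt_0_iff)
  have m: "m \<ge> 0" using assms(2) n by (auto simp: m_def intro!: sum_nonneg divide_nonneg_pos)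
  \<comment> \<open>Tangent line of the cube at the mean.\<close>
  have tangent: "m ^ 3 + 3 * m\<^sup>2 * (x - m) \<le> x ^ 3" if "x \<ge> 0" for x
  proof -
    have "x ^ 3 - (m ^ 3 + 3 * m\<^sup>2 * (x - m)) = (x - m)\<^sup>2 * (x + 2 * m)"
      by (simp add: power3_eq_cube power2_eq_square algebra_simps)
    then show ?thesis using that m by (smt (verit) mult_nonneg_nonneg zero_le_power2)
  qed
  \<comment> \<open>The linear terms of the tangent lines cancel in the sum because \<open>m\<close>
    is the mean.\<close>
  have "n * m ^ 3 = (\<Sum>i\<in>I. m ^ 3 + 3 * m\<^sup>2 * (f i - m))"
    using n by (simp add: sum.distrib sum_subtractf flip: sum_distrib_left)
      (simp add: m_def n_def)
  also have "\<dots> \<le> (\<Sum>i\<in>I. f i ^ 3)"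
    by (intro sum_mono tangent assms(2))
  finally have "n\<^sup>2 * (n * m ^ 3) \<le> n\<^sup>2 * (\<Sum>i\<in>I. f i ^ 3)"
    by (intro mult_left_mono) auto
  moreover have "n\<^sup>2 * (n * m ^ 3) = (\<Sum>i\<in>I. f i) ^ 3"
    using n by (simp add: m_def power3_eq_cube power2_eq_square)
  ultimately show ?thesis by (simp add: n_def)
qed auto

lemma sum_mult_of_bool_eq:
  fixes u :: "'a \<Rightarrow> real"
  assumes "finite A" "a \<in> A"
  shows "(\<Sum>w\<in>A. u w * of_bool (a = w)) = u a"
proof -
  have "(\<Sum>w\<in>A. u w * of_bool (a = w)) = (\<Sum>w\<in>A. if a = w then u w else 0)"
    by (intro sum.cong) auto
  then show ?thesis using assms by simp
qed

section \<open>Functions with constant weak second derivative\<close>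

lemma has_real_derivative_pos_part_power:
  fixes x :: real
  assumes n: "0 < n"
  shows "((\<lambda>x. max 0 x ^ Suc n) has_real_derivative real (Suc n) * max 0 x ^ n) (at x)"
proof -
  consider "x < 0" | "x = 0" | "x > 0" by linarith
  then show ?thesis
  proof cases
    case 1
    have "((\<lambda>x. 0) has_real_derivative real (Suc n) * max 0 x ^ n) (at x)"
      using 1 n by (simp add: zero_power)
    then show ?thesis
      by (rule has_field_derivative_transform_within_open[where S = "{..<0}"]) (use 1 in auto)
  next
    case 2
    have "((\<lambda>h. max 0 h ^ n) \<longlongrightarrow> max 0 0 ^ n) (at (0::real))"
      by (intro tendsto_intros)
    \<comment> \<open>At the knot the difference quotient is itself a truncated power, of positive
      exponent, so it tends to 0 from both sides.\<close>
    moreover have "eventually (\<lambda>h. max 0 h ^ n = (max 0 (0 + h) ^ Suc n - max 0 0 ^ Suc n) / h) (at (0::real))"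
      using n by (auto simp: eventually_at_filter max_def zero_power)
    ultimately have "((\<lambda>h. (max 0 (0 + h) ^ Suc n - max 0 0 ^ Suc n) / h) \<longlongrightarrow> max 0 0 ^ n) (at (0::real))"
      by (rule Lim_transform_eventually)
    then show ?thesis using 2 n by (simp add: DERIV_def zero_power)
  next
    case 3
    have "((\<lambda>x. x ^ Suc n) has_real_derivative real (Suc n) * max 0 x ^ n) (at x)"
      using 3 DERIV_pow[of "Suc n" x] by simp
    then show ?thesis
      by (rule has_field_derivative_transform_within_open[where S = "{0<..}"]) (use 3 in auto)
  qed
qed

text \<open>The second central difference, with step \<open>r\<close>, of the truncated power of
  degree \<open>n\<close> divided by n!. Degree 1 gives the hat function of radius \<open>r\<close>,
  and each further degree is an antiderivative of the one before.\<close>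

definition spline :: "real \<Rightarrow> nat \<Rightarrow> real \<Rightarrow> real" where
  "spline r n x = (max 0 (x + r) ^ n - 2 * max 0 x ^ n + max 0 (x - r) ^ n) / fact n"

lemma has_real_derivative_spline:
  assumes "0 < n"
  shows "(spline r (Suc n) has_real_derivative spline r n x) (at x)"
proof -
  have *: "((\<lambda>x. max 0 (x + c) ^ Suc n) has_real_derivative real (Suc n) * max 0 (x + c) ^ n) (at x)" for c
    using has_real_derivative_pos_part_power[OF assms, of "x + c"] unfolding DERIV_shift .
  have "((\<lambda>x. (max 0 (x + r) ^ Suc n - 2 * max 0 (x + 0) ^ Suc n + max 0 (x + - r) ^ Suc n) / fact (Suc n))
    has_real_derivative
    (real (Suc n) * max 0 (x + r) ^ n - 2 * (real (Suc n) * max 0 (x + 0) ^ n) +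
      real (Suc n) * max 0 (x + - r) ^ n) / fact (Suc n)) (at x)"
    by (intro DERIV_cdivide DERIV_add DERIV_diff DERIV_cmult *)
  moreover have "(real (Suc n) * max 0 (x + r) ^ n - 2 * (real (Suc n) * max 0 (x + 0) ^ n) +
      real (Suc n) * max 0 (x + - r) ^ n) / fact (Suc n) =
      real (Suc n) * (max 0 (x + r) ^ n - 2 * max 0 x ^ n + max 0 (x - r) ^ n) / (real (Suc n) * fact n)"
    by (simp add: algebra_simps)
  then have "(real (Suc n) * max 0 (x + r) ^ n - 2 * (real (Suc n) * max 0 (x + 0) ^ n) +
      real (Suc n) * max 0 (x + - r) ^ n) / fact (Suc n) = spline r n x"
    unfolding spline_def by (subst (asm) mult_divide_mult_cancel_left) simp_all
  ultimately show ?thesis by (simp add: spline_def[abs_def])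
qed

lemma spline_1: "0 \<le> r \<Longrightarrow> spline r (Suc 0) x = max 0 (r - \<bar>x\<bar>)"
  by (auto simp: spline_def max_def)

lemma continuous_on_spline [continuous_intros]:
  "continuous_on S f \<Longrightarrow> continuous_on S (\<lambda>x. spline r n (f x))"
  unfolding spline_def by (intro continuous_intros) simp_all

text \<open>Fourth-order differences annihilate cubic polynomials.\<close>

lemma spline_difference_eq_0:
  assumes "0 < r" "0 < d" "x \<notin> {- d - r..d + r}"
  shows "spline r 3 (x + d) - 2 * spline r 3 x + spline r 3 (x - d) = 0"
proof -
  consider "x < - d - r" | "x > d + r" using assms(3) by fastforce
  then show ?thesis
  proof cases
    case 1
    then show ?thesis using assms(1,2) by (simp add: spline_def)
  next
    case 2
    \<comment> \<open>To the right of all knots the second difference of y^3 / 6 is linear, and one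
      more second difference kills it.\<close>
    have "spline r 3 y = r\<^sup>2 * y" if "y > r" for y
      using that assms(1) 
      by (simp add: spline_def fact_numeral power3_eq_cube power2_eq_square algebra_simps)
    then show ?thesis using 2 assms(1,2) by (simp add: algebra_simps)
  qed
qed

text \<open>A translation moves the shift from the test function to \<open>F\<close>; since the
  shifted support stays inside (0, l), the ends of the interval do not interfere. In this way a
  second difference of the hat becomes a second difference of \<open>F\<close>.\<close>

lemma LINT_shift_compact_support:
  fixes F \<beta> :: "real \<Rightarrow> real"
  assumes "0 < a + s" "b + s < l" and \<beta>: "\<And>t. t \<notin> {a..b} \<Longrightarrow> \<beta> t = 0"
  shows "(LINT x:{0<..<l}|lborel. F x * \<beta> (x - s)) = (LINT t:{a..b}|lborel. F (t + s) * \<beta> t)"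
  unfolding set_lebesgue_integral_def
proof (subst lborel_integral_real_affine[where c = 1 and t = s])
  have eq: "indicator {0<..<l} (s + 1 * t) *\<^sub>R (F (s + 1 * t) * \<beta> (s + 1 * t - s)) =
      indicator {a..b} t *\<^sub>R (F (t + s) * \<beta> t)" for t
  proof (cases "t \<in> {a..b}")
    case True
    then show ?thesis using assms(1,2) by (auto simp: indicator_def add.commute)
  next
    case False
    then show ?thesis using \<beta>[OF False] by auto
  qed
  show "\<bar>1\<bar> *\<^sub>R (LINT x|lborel. indicator {0<..<l} (s + 1 * x) *\<^sub>R (F (s + 1 * x) * \<beta> (s + 1 * x - s))) =
      (LINT t|lborel. indicator {a..b} t *\<^sub>R (F (t + s) * \<beta> t))"
    unfolding eq by simp
qed simp

lemma set_integrable_greaterThanLessThan: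
  fixes f :: "real \<Rightarrow> real"
  assumes "continuous_on {a..b} f"
  shows "set_integrable lborel {a<..<b} f"
  using borel_integrable_atLeastAtMost'[OF assms] by (rule set_integrable_subset) auto

lemma LINT_greaterThanLessThan:
  fixes f :: "real \<Rightarrow> real"
  shows "(LINT x:{a<..<b}|lborel. f x) = (LINT x:{a..b}|lborel. f x)"
  by (rule set_integral_discrete_difference[where X = "{a, b}"]) (auto simp: order_less_le)

lemma LINT_second_difference:
  fixes f g h :: "'a \<Rightarrow> real"
  assumes "set_integrable M A f" "set_integrable M A g" "set_integrable M A h"
  shows "(LINT x:A|M. f x - 2 * g x + h x) = (LINT x:A|M. f x) - 2 * (LINT x:A|M. g x) + (LINT x:A|M. h x)"
  using assms by (simp add: set_integral_add(2) set_integral_diff set_integral_mult_right)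

text \<open>At the smallest maximizer of \<open>F\<close> a second difference of \<open>F\<close> is negative; test with a second
  difference of a narrow hat function.\<close>

lemma weakly_affine_le_0:
  fixes F :: "real \<Rightarrow> real"
  assumes F: "continuous_on {0..l} F" "F 0 = 0" "F l = 0"
    and weak: "\<And>\<phi> \<phi>' \<phi>'' a b. \<lbrakk>\<And>x. (\<phi> has_real_derivative \<phi>' x) (at x);
      \<And>x. (\<phi>' has_real_derivative \<phi>'' x) (at x); continuous_on UNIV \<phi>'';
      0 < a; b < l; \<And>x. x \<notin> {a..b} \<Longrightarrow> \<phi> x = 0\<rbrakk>
      \<Longrightarrow> (LINT x:{0<..<l}|lborel. F x * \<phi>'' x) = 0"
    and x: "x \<in> {0..l}"
  shows "F x \<le> 0"
proof (rule ccontr)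
  assume "\<not> F x \<le> 0"
  obtain z where z: "z \<in> {0..l}" and z_max: "\<And>y. y \<in> {0..l} \<Longrightarrow> F y \<le> F z"
    using continuous_attains_sup[OF compact_Icc _ F(1)] x by blast
  define Z where "Z = {y \<in> {0..l}. F y = F z}"
  have "closed Z"
    unfolding Z_def by (intro continuous_closed_preimage_constant F(1) closed_atLeastAtMost)
  then have "compact ({0..l} \<inter> Z)" by (rule compact_Int_closed[OF compact_Icc])
  moreover have "{0..l} \<inter> Z = Z" by (auto simp: Z_def)
  ultimately have "compact Z" by simp
  moreover have "z \<in> Z" using z by (simp add: Z_def)
  ultimately obtain c where "c \<in> Z" and c_min: "\<And>y. y \<in> Z \<Longrightarrow> c \<le> y"
    using compact_attains_inf[of Z] by blast
  then have c: "c \<in> {0..l}" "F c = F z" by (auto simp: Z_def)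
  have "F c > 0" using z_max[OF x] \<open>\<not> F x \<le> 0\<close> c(2) by simp
  then have "c \<noteq> 0" "c \<noteq> l" using F(2,3) by auto
  then have c_pos: "0 < c" "c < l" using c(1) by auto
  \<comment> \<open>Keeps \<open>c - 2 * d\<close> and \<open>c + 2 * d\<close> inside [0, l], so
    that second differences with step \<open>d\<close> can be formed on a whole neighbourhood of
    \<open>c\<close>.\<close>
  define d where "d = min c (l - c) / 2"
  have d: "0 < d" "2 * d \<le> c" "2 * d \<le> l - c" using c_pos by (auto simp: d_def)
  define D where "D t = F (t - d) - 2 * F t + F (t + d)" for t
  \<comment> \<open>The choice of the smallest maximizer makes the left neighbour strictly smaller,
    hence \<open>D c\<close> strictly negative.\<close>
  have "c - d \<notin> Z" using c_min[of "c - d"] d(1) by auto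
  then have "F (c - d) < F z" using z_max[of "c - d"] d c_pos by (auto simp: Z_def)
  moreover have "F (c + d) \<le> F z" using z_max[of "c + d"] d c_pos by auto
  ultimately have D_c: "D c < 0" using c(2) by (simp add: D_def)
  have D_cont: "continuous_on {c - d..c + d} D"
    unfolding D_def using d
    by (intro continuous_intros continuous_on_compose2[OF F(1)]) auto
  then obtain r' where r': "0 < r'" "\<And>t. \<lbrakk>t \<in> {c - d..c + d}; dist t c < r'\<rbrakk> \<Longrightarrow> dist (D t) (D c) < - D c"
    using D_c d(1) unfolding continuous_on_iff by (metis atLeastAtMost_iff add_increasing2 diff_le_eq le_add_same_cancel1 less_imp_le neg_0_less_iff_less order_refl)
  define r where "r = min (r' / 2) (d / 2)"
  have r: "0 < r" "r < d" "r < r'" using r'(1) d(1) by (auto simp: r_def)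
  have D_neg: "D t < 0" if "t \<in> {c - r..c + r}" for t
  proof -
    have "dist t c < r'" using that r by (auto simp: dist_real_def abs_le_iff)
    then have "dist (D t) (D c) < - D c" using r'(2)[of t] that r by auto
    then show ?thesis by (simp add: dist_real_def)
  qed
  define \<beta> where "\<beta> t = spline r (Suc 0) (t - c)" for t
  \<comment> \<open>The second difference with step \<open>d\<close> of the spline centred at
    \<open>c\<close>. Degree 3 has compact support in (0, l), and its second derivative, of degree
    1, is the second difference of the hat \<open>\<beta>\<close>.\<close>
  define \<phi> where "\<phi> n x = spline r n (x + (d - c)) - 2 * spline r n (x + - c) + spline r n (x + (- c - d))" for n x
  have \<beta>_nonneg: "0 \<le> \<beta> t" and \<beta>_eq_0: "t \<notin> {c - r..c + r} \<Longrightarrow> \<beta> t = 0" for t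
    using r(1) unfolding \<beta>_def by (auto simp: spline_1 abs_if)
  have \<beta>_cont: "continuous_on S \<beta>" for S
    unfolding \<beta>_def by (intro continuous_intros)
  have \<phi>_deriv: "(\<phi> (Suc n) has_real_derivative \<phi> n x) (at x)" if "0 < n" for n x
  proof -
    have "((\<lambda>x. spline r (Suc n) (x + s)) has_real_derivative spline r n (x + s)) (at x)" for s
      using has_real_derivative_spline[OF that, of r "x + s"] unfolding DERIV_shift .
    then show ?thesis
      unfolding \<phi>_def by (intro DERIV_add DERIV_diff DERIV_cmult)
  qed
  have "(LINT x:{0<..<l}|lborel. F x * \<phi> (Suc 0) x) = 0"
  proof (rule weak)
    show "(\<phi> 3 has_real_derivative \<phi> 2 x) (at x)" for x
      using \<phi>_deriv[of 2 x] by (simp add: numeral_eq_Suc)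
    show "(\<phi> 2 has_real_derivative \<phi> (Suc 0) x) (at x)" for x
      using \<phi>_deriv[of "Suc 0" x] by (simp add: numeral_eq_Suc)
    show "continuous_on UNIV (\<phi> (Suc 0))"
      unfolding \<phi>_def by (intro continuous_intros)
    show "0 < c - d - r" "c + d + r < l" using r d by auto
    show "\<phi> 3 x = 0" if "x \<notin> {c - d - r..c + d + r}" for x
      using spline_difference_eq_0[OF r(1) d(1), of "x - c"] that by (auto simp: \<phi>_def algebra_simps)
  qed
  also have "(\<lambda>x. F x * \<phi> (Suc 0) x) = (\<lambda>x. F x * \<beta> (x - (- d)) - 2 * (F x * \<beta> (x - 0)) + F x * \<beta> (x - d))"
    by (auto simp: \<phi>_def \<beta>_def algebra_simps)
  also have "(LINT x:{0<..<l}|lborel. F x * \<beta> (x - (- d)) - 2 * (F x * \<beta> (x - 0)) + F x * \<beta> (x - d)) =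
      (LINT x:{0<..<l}|lborel. F x * \<beta> (x - (- d))) - 2 * (LINT x:{0<..<l}|lborel. F x * \<beta> (x - 0)) +
      (LINT x:{0<..<l}|lborel. F x * \<beta> (x - d))"
  proof -
    have "set_integrable lborel {0<..<l} (\<lambda>x. F x * \<beta> (x - s))" for s
      by (intro set_integrable_greaterThanLessThan continuous_intros F(1) continuous_on_compose2[OF \<beta>_cont[of UNIV]]) auto
    then show ?thesis by (intro LINT_second_difference)
  qed
  also have "\<dots> = (LINT t:{c - r..c + r}|lborel. F (t + (- d)) * \<beta> t) - 2 * (LINT t:{c - r..c + r}|lborel. F (t + 0) * \<beta> t) +
      (LINT t:{c - r..c + r}|lborel. F (t + d) * \<beta> t)"
    using r d by (subst (1 2 3) LINT_shift_compact_support[where a = "c - r" and b = "c + r"]) (auto simp: \<beta>_eq_0)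
  also have "\<dots> = (LINT t:{c - r..c + r}|lborel. D t * \<beta> t)"
  proof -
    have int: "set_integrable lborel {c - r..c + r} (\<lambda>t. F (t + s) * \<beta> t)" if "\<bar>s\<bar> \<le> d" for s
      using that r d
      by (intro borel_integrable_atLeastAtMost' continuous_intros \<beta>_cont continuous_on_compose2[OF F(1)]) auto
    have "(LINT t:{c - r..c + r}|lborel. F (t + - d) * \<beta> t - 2 * (F (t + 0) * \<beta> t) + F (t + d) * \<beta> t) =
        (LINT t:{c - r..c + r}|lborel. F (t + - d) * \<beta> t) -
        2 * (LINT t:{c - r..c + r}|lborel. F (t + 0) * \<beta> t) +
        (LINT t:{c - r..c + r}|lborel. F (t + d) * \<beta> t)"
      using d(1) by (intro LINT_second_difference int) simp_all
    moreover have "F (t + - d) * \<beta> t - 2 * (F (t + 0) * \<beta> t) + F (t + d) * \<beta> t = D t * \<beta> t" for t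
      by (simp add: D_def algebra_simps)
    ultimately show ?thesis by simp
  qed
  finally have "(LINT t:{c - r..c + r}|lborel. D t * \<beta> t) = 0" .
  moreover have cont: "continuous_on {c - r..c + r} (\<lambda>t. D t * \<beta> t)"
    using r by (intro continuous_intros \<beta>_cont continuous_on_subset[OF D_cont]) auto
  ultimately have "integral {c - r..c + r} (\<lambda>t. D t * \<beta> t) = 0"
    using set_borel_integral_eq_integral(2)[OF borel_integrable_atLeastAtMost'[OF cont]] by simp
  then have "integral {c - r..c + r} (\<lambda>t. - (D t * \<beta> t)) = 0" by simp
  \<comment> \<open>A continuous integrand of constant sign with zero integral vanishes everywhere,
    but at \<open>c\<close> both factors are nonzero.\<close>
  moreover have "0 \<le> - (D t * \<beta> t)" if "t \<in> {c - r..c + r}" for t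
    using D_neg[OF that] \<beta>_nonneg[of t] by (simp add: mult_le_0_iff)
  ultimately have "\<forall>t\<in>{c - r..c + r}. - (D t * \<beta> t) = 0"
    using integral_eq_0_iff[of "c - r" "c + r" "\<lambda>t. - (D t * \<beta> t)"] cont r(1)
    by (simp add: continuous_on_minus)
  then have "D c * \<beta> c = 0" using r(1) by auto
  then show False using D_c r(1) by (simp add: \<beta>_def spline_1)
qed

section \<open>The explicit solution on a single edge\<close>

lemma weak_deriv_C1:
  assumes "0 \<le> l" and f: "\<And>x. (f has_real_derivative f' x) (at x)" "continuous_on UNIV f'"
  shows "weak_deriv l f f'"
  unfolding weak_deriv_def
proof (intro allI impI, elim conjE exE)
  fix \<phi> \<phi>' :: "real \<Rightarrow> real" and a b :: real
  assume \<phi>: "\<forall>x. (\<phi> has_real_derivative \<phi>' x) (at x)" "continuous_on UNIV \<phi>'"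
    and supp: "0 < a" "b < l" "\<forall>x. x \<notin> {a..b} \<longrightarrow> \<phi> x = 0"
  have cont: "continuous_on S f" "continuous_on S \<phi>" for S
    by (intro continuous_at_imp_continuous_on ballI DERIV_isCont[OF f(1)]
        DERIV_isCont[OF \<phi>(1)[rule_format]])+
  have cont': "continuous_on S f'" "continuous_on S \<phi>'" for S
    using continuous_on_subset[OF f(2)] continuous_on_subset[OF \<phi>(2)] by auto
  have "(LINT x:{0..l}|lborel. f x * \<phi>' x + f' x * \<phi> x) = f l * \<phi> l - f 0 * \<phi> 0"
    unfolding set_lebesgue_integral_def
  proof (rule integral_FTC_atLeastAtMost[OF \<open>0 \<le> l\<close>])
    show "((\<lambda>x. f x * \<phi> x) has_vector_derivative f x * \<phi>' x + f' x * \<phi> x) (at x within {0..l})" for x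
      using DERIV_mult'[OF f(1) \<phi>(1)[rule_format], of x]
      unfolding has_real_derivative_iff_has_vector_derivative
      by (rule has_vector_derivative_at_within)
    show "continuous_on {0..l} (\<lambda>x. f x * \<phi>' x + f' x * \<phi> x)"
      by (intro continuous_intros cont cont')
  qed
  then have "(LINT x:{0<..<l}|lborel. f x * \<phi>' x + f' x * \<phi> x) = 0"
    using supp by (simp add: LINT_greaterThanLessThan)
  then show "(LINT x:{0<..<l}|lborel. f x * \<phi>' x) = - (LINT x:{0<..<l}|lborel. f' x * \<phi> x)"
    by (subst (asm) set_integral_add)
      (auto intro!: set_integrable_greaterThanLessThan continuous_intros cont cont')
qed

lemma L2_on_continuous:
  assumes "continuous_on {0..l} f"
  shows "L2_on l f"
  unfolding L2_on_def
proof
  show "set_borel_measurable lborel {0<..<l} f"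
    using set_integrable_greaterThanLessThan[OF assms]
    unfolding set_integrable_def set_borel_measurable_def by (rule borel_measurable_integrable)
  show "set_integrable lborel {0<..<l} (\<lambda>x. (f x)\<^sup>2)"
    by (intro set_integrable_greaterThanLessThan continuous_intros assms)
qed

lemma L2_on_cong:
  assumes "\<And>x. x \<in> {0<..<l} \<Longrightarrow> f x = g x"
  shows "L2_on l f \<longleftrightarrow> L2_on l g"
proof -
  have "(\<lambda>x. indicator {0<..<l} x *\<^sub>R f x) = (\<lambda>x. indicator {0<..<l} x *\<^sub>R g x)"
    "(\<lambda>x. indicator {0<..<l} x *\<^sub>R (f x)\<^sup>2) = (\<lambda>x. indicator {0<..<l} x *\<^sub>R (g x)\<^sup>2)"
    using assms by (auto simp: indicator_def)
  then show ?thesis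
    unfolding L2_on_def set_borel_measurable_def set_integrable_def by simp
qed

lemma weak_deriv_cong:
  assumes "\<And>x. x \<in> {0<..<l} \<Longrightarrow> f x = g x"
  shows "weak_deriv l f h \<longleftrightarrow> weak_deriv l g h"
proof -
  have "(LINT x:{0<..<l}|lborel. f x * \<phi>' x) = (LINT x:{0<..<l}|lborel. g x * \<phi>' x)" for \<phi>'
    using assms by (intro set_lebesgue_integral_cong) auto
  then show ?thesis by (simp add: weak_deriv_def)
qed

definition edge_profile :: "real \<Rightarrow> real \<Rightarrow> real \<Rightarrow> real \<Rightarrow> real" where
  "edge_profile l a b x = a + (b - a) / l * x + x * (l - x) / 2"

lemma has_real_derivative_edge_profile:
  "(edge_profile l a b has_real_derivative (b - a) / l + l / 2 - x) (at x)"
proof -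
  have "((\<lambda>x. a + c * x + x * (l - x) / 2) has_real_derivative c + l / 2 - x) (at x)" for c
    by (auto intro!: derivative_eq_intros simp: field_simps)
  then show ?thesis unfolding edge_profile_def[abs_def] .
qed

lemma edge_profile_ends [simp]:
  "edge_profile l a b 0 = a" "0 < l \<Longrightarrow> edge_profile l a b l = b"
  by (auto simp: edge_profile_def)

lemma continuous_on_edge_profile: "continuous_on S (edge_profile l a b)"
  unfolding edge_profile_def[abs_def] by (cases "l = 0") (auto intro!: continuous_intros)

lemma weak_deriv_edge_profile:
  assumes "0 < l"
  shows "weak_deriv l (edge_profile l a b) (\<lambda>x. (b - a) / l + l / 2 - x)"
    "weak_deriv l (\<lambda>x. (b - a) / l + l / 2 - x) (\<lambda>x. - 1)"
  using assms
  by (auto intro!: weak_deriv_C1 has_real_derivative_edge_profile continuous_intros derivative_eq_intros)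

lemma H2_with_edge_profile:
  assumes "0 < l" and f: "\<And>x. x \<in> {0<..<l} \<Longrightarrow> f x = edge_profile l a b x"
  shows "H2_with l f (\<lambda>x. - 1)"
  unfolding H2_with_def
proof (intro exI conjI)
  show "L2_on l f"
    using L2_on_continuous[OF continuous_on_edge_profile] L2_on_cong[of l f, OF f] by blast
  show "weak_deriv l f (\<lambda>x. (b - a) / l + l / 2 - x)"
    using weak_deriv_edge_profile(1)[OF assms(1)] weak_deriv_cong[of l f, OF f] by blast
  show "weak_deriv l (\<lambda>x. (b - a) / l + l / 2 - x) (\<lambda>x. - 1)"
    by (rule weak_deriv_edge_profile(2)[OF assms(1)])
qed (auto intro!: L2_on_continuous continuous_intros)

text \<open>The affine part contributes the trapezoid value. The remaining \<open>l ^ 3 / 12\<close>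
  is the rigidity of an interval with both ends held at 0.\<close>

lemma LINT_edge_profile:
  assumes "0 < l"
  shows "(LINT x:{0..l}|lborel. edge_profile l a b x) = (a + b) * (l / 2) + l ^ 3 / 12"
proof -
  define P where "P x = a * x + (b - a) / l * (x\<^sup>2 / 2) + (l * (x\<^sup>2 / 2) - x ^ 3 / 3) / 2" for x
  have "((\<lambda>x. a * x + c * (x\<^sup>2 / 2) + (l * (x\<^sup>2 / 2) - x ^ 3 / 3) / 2) has_vector_derivative
      a + c * x + x * (l - x) / 2) (at x within {0..l})" for c x
    unfolding has_real_derivative_iff_has_vector_derivative[symmetric]
    by (auto intro!: derivative_eq_intros simp: power2_eq_square field_simps)
  then have "(P has_vector_derivative edge_profile l a b x) (at x within {0..l})" for x
    unfolding P_def edge_profile_def .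
  then have "(LINT x:{0..l}|lborel. edge_profile l a b x) = P l - P 0"
    unfolding set_lebesgue_integral_def using assms
    by (intro integral_FTC_atLeastAtMost continuous_on_edge_profile) auto
  also have "\<dots> = (a + b) * (l / 2) + l ^ 3 / 12"
    using assms by (simp add: P_def power2_eq_square power3_eq_cube field_simps)
  finally show ?thesis .
qed

text \<open>Two integrations by parts show that \<open>f\<close> and the profile have the same
  integral against every second derivative of a test function. Their difference vanishes at both
  ends, and the maximum argument applies to it and to its negative.\<close>

lemma H2_with_eq_edge_profile:
  assumes l: "0 < l" and f: "continuous_on {0..l} f" and h: "H2_with l f h"
    and h_eq: "AE x in lborel. x \<in> {0<..<l} \<longrightarrow> - h x = 1" and x: "x \<in> {0..l}"
  shows "f x = edge_profile l (f 0) (f l) x"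
proof -
  define q where "q = edge_profile l (f 0) (f l)"
  have q_cont: "continuous_on S q" for S
    by (simp add: q_def continuous_on_edge_profile)
  obtain g where h_L2: "L2_on l h" and fg: "weak_deriv l f g" and gh: "weak_deriv l g h"
    using h by (auto simp: H2_with_def)
  have h_meas [measurable]: "(\<lambda>x. indicator {0<..<l} x *\<^sub>R h x) \<in> borel_measurable lborel"
    using h_L2 by (simp add: L2_on_def set_borel_measurable_def)
  have weak: "(LINT x:{0<..<l}|lborel. (f x - q x) * \<phi>'' x) = 0"
    if \<phi>: "\<And>x. (\<phi> has_real_derivative \<phi>' x) (at x)" "\<And>x. (\<phi>' has_real_derivative \<phi>'' x) (at x)"
      "continuous_on UNIV \<phi>''" and ab: "0 < a" "b < l" and supp: "\<And>x. x \<notin> {a..b} \<Longrightarrow> \<phi> x = 0"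
    for \<phi> \<phi>' \<phi>'' a b
  proof -
    have \<phi>_cont: "continuous_on S \<phi>" "continuous_on S \<phi>'" for S
      by (intro continuous_at_imp_continuous_on ballI DERIV_isCont[OF \<phi>(1)] DERIV_isCont[OF \<phi>(2)])+
    have \<phi>''_cont: "continuous_on S \<phi>''" for S using continuous_on_subset[OF \<phi>(3)] by auto
    \<comment> \<open>The first integration by parts tests with \<open>\<phi>'\<close>, which
      therefore needs compact support as well.\<close>
    have supp': "\<phi>' x = 0" if x: "x \<notin> {a..b}" for x
    proof -
      have "open (- {a..b})" by auto
      then have "((\<lambda>x. 0) has_real_derivative \<phi>' x) (at x)"
        using x supp by (intro has_field_derivative_transform_within_open[OF \<phi>(1)]) auto
      then show ?thesis using DERIV_unique DERIV_const by blast
    qed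
    have by_parts: "(LINT x:{0<..<l}|lborel. u x * \<phi>'' x) = (LINT x:{0<..<l}|lborel. u'' x * \<phi> x)"
      if "weak_deriv l u u'" "weak_deriv l u' u''" for u u' u''
    proof -
      have "(LINT x:{0<..<l}|lborel. u x * \<phi>'' x) = - (LINT x:{0<..<l}|lborel. u' x * \<phi>' x)"
        using that(1) \<phi>(2,3) ab supp' unfolding weak_deriv_def by blast
      also have "(LINT x:{0<..<l}|lborel. u' x * \<phi>' x) = - (LINT x:{0<..<l}|lborel. u'' x * \<phi> x)"
        using that(2) \<phi>(1) \<phi>_cont(2) ab supp unfolding weak_deriv_def by blast
      finally show ?thesis by simp
    qed
    have "(LINT x:{0<..<l}|lborel. h x * \<phi> x) = (LINT x:{0<..<l}|lborel. - 1 * \<phi> x)"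
      unfolding set_lebesgue_integral_def
    proof (rule integral_cong_AE)
      \<comment> \<open>Only the product of \<open>h\<close> with the indicator is known to be
        measurable, so the factors are grouped accordingly.\<close>
      have "(\<lambda>x. (indicator {0<..<l} x *\<^sub>R h x) * \<phi> x) \<in> borel_measurable lborel"
        using borel_measurable_continuous_onI[OF \<phi>_cont(1)] by measurable
      then show "(\<lambda>x. indicator {0<..<l} x *\<^sub>R (h x * \<phi> x)) \<in> borel_measurable lborel"
        by (simp add: mult.assoc)
      show "(\<lambda>x. indicator {0<..<l} x *\<^sub>R (- 1 * \<phi> x)) \<in> borel_measurable lborel"
        using borel_measurable_continuous_onI[OF \<phi>_cont(1)] by measurable
      show "AE x in lborel. indicator {0<..<l} x *\<^sub>R (h x * \<phi> x) = indicator {0<..<l} x *\<^sub>R (- 1 * \<phi> x)"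
        using h_eq by eventually_elim (auto simp: indicator_def)
    qed
    then have "(LINT x:{0<..<l}|lborel. f x * \<phi>'' x) = (LINT x:{0<..<l}|lborel. q x * \<phi>'' x)"
      using by_parts[OF fg gh] by_parts[OF weak_deriv_edge_profile[OF l]] by (simp add: q_def)
    moreover have "set_integrable lborel {0<..<l} (\<lambda>x. f x * \<phi>'' x)"
      "set_integrable lborel {0<..<l} (\<lambda>x. q x * \<phi>'' x)"
      by (intro set_integrable_greaterThanLessThan continuous_intros f q_cont \<phi>''_cont)+
    ultimately show ?thesis by (simp add: left_diff_distrib set_integral_diff)
  qed
  have "f x - q x \<le> 0"
  proof (rule weakly_affine_le_0[where F = "\<lambda>x. f x - q x" and l = l, OF _ _ _ _ x])
    show "continuous_on {0..l} (\<lambda>x. f x - q x)" by (intro continuous_intros f q_cont)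
    show "(LINT x:{0<..<l}|lborel. (f x - q x) * \<phi>'' x) = 0"
      if "\<And>x. (\<phi> has_real_derivative \<phi>' x) (at x)" "\<And>x. (\<phi>' has_real_derivative \<phi>'' x) (at x)"
        "continuous_on UNIV \<phi>''" "0 < a" "b < l" "\<And>x. x \<notin> {a..b} \<Longrightarrow> \<phi> x = 0"
      for \<phi> \<phi>' \<phi>'' a b
      by (rule weak[of \<phi> \<phi>' \<phi>'' a b]; fact)
  qed (use l in \<open>simp_all add: q_def\<close>)
  moreover have "q x - f x \<le> 0"
  proof (rule weakly_affine_le_0[where F = "\<lambda>x. q x - f x" and l = l, OF _ _ _ _ x])
    show "continuous_on {0..l} (\<lambda>x. q x - f x)" by (intro continuous_intros f q_cont)
    show "(LINT x:{0<..<l}|lborel. (q x - f x) * \<phi>'' x) = 0"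
      if "\<And>x. (\<phi> has_real_derivative \<phi>' x) (at x)" "\<And>x. (\<phi>' has_real_derivative \<phi>'' x) (at x)"
        "continuous_on UNIV \<phi>''" "0 < a" "b < l" "\<And>x. x \<notin> {a..b} \<Longrightarrow> \<phi> x = 0"
      for \<phi> \<phi>' \<phi>'' a b
    proof -
      have "(LINT x:{0<..<l}|lborel. (f x - q x) * \<phi>'' x) = 0"
        by (rule weak[of \<phi> \<phi>' \<phi>'' a b]; fact)
      then have "(LINT x:{0<..<l}|lborel. - 1 * ((f x - q x) * \<phi>'' x)) = 0"
        unfolding set_integral_mult_right by simp
      moreover have "- 1 * ((f x - q x) * \<phi>'' x) = (q x - f x) * \<phi>'' x" for x
        by (simp add: left_diff_distrib)
      ultimately show ?thesis by simp
    qed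
  qed (use l in \<open>simp_all add: q_def\<close>)
  ultimately show ?thesis by (simp add: q_def)
qed

section \<open>The discrete problem for the vertex values\<close>

lemma edge_point_in_mg_points:
  "e \<in> arcs G \<Longrightarrow> x \<in> {0..len e} \<Longrightarrow> edge_point G len e x \<in> mg_points G len"
  unfolding mg_points_def by blast

lemma topspace_mg_topology: "topspace (mg_topology G len) = mg_points G len"
proof
  show "topspace (mg_topology G len) \<subseteq> mg_points G len"
    using openin_topspace[of "mg_topology G len"] unfolding openin_mg_topology by (rule conjunct1)
  have "{x \<in> {0..len e}. edge_point G len e x \<in> mg_points G len} = {0..len e}" if "e \<in> arcs G" for e
    using edge_point_in_mg_points[OF that] by blast
  then have "openin (mg_topology G len) (mg_points G len)"
    by (simp add: openin_mg_topology)
  then show "mg_points G len \<subseteq> topspace (mg_topology G len)" by (rule openin_subset)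
qed

text \<open>The universal property of the quotient: a preimage is open exactly if its trace on every
  edge is.\<close>

lemma continuous_map_mg_topology_iff:
  "continuous_map (mg_topology G len) euclideanreal v \<longleftrightarrow>
     (\<forall>e\<in>arcs G. continuous_on {0..len e} (on_edge G len v e))"
proof -
  have "{x \<in> {0..len e}. edge_point G len e x \<in> {p \<in> mg_points G len. v p \<in> U}} =
      {0..len e} \<inter> on_edge G len v e -` U" if "e \<in> arcs G" for e U
    using edge_point_in_mg_points[OF that] by (auto simp: on_edge_def)
  then have "openin (mg_topology G len) {p \<in> mg_points G len. v p \<in> U} \<longleftrightarrow>
      (\<forall>e\<in>arcs G. openin (top_of_set {0..len e}) ({0..len e} \<inter> on_edge G len v e -` U))" for U
    by (simp add: openin_mg_topology)
  then show ?thesis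
    unfolding continuous_map_def topspace_mg_topology continuous_openin_preimage_eq
    by (simp, blast)
qed

context metric_graph
begin

text \<open>The signed incidence matrix. A loop has entry 0 here, whereas it counts twice in
  \<open>ends\<close>.\<close>

definition inc :: "'v \<Rightarrow> 'e \<Rightarrow> real" where
  "inc w e = of_bool (head G e = w) - of_bool (tail G e = w)"

definition ends :: "'v \<Rightarrow> 'e \<Rightarrow> real" where
  "ends w e = of_bool (head G e = w) + of_bool (tail G e = w)"

definition jump :: "('v \<Rightarrow> real) \<Rightarrow> 'e \<Rightarrow> real" where
  "jump u e = u (head G e) - u (tail G e)"

text \<open>Net inflow, so that for the slopes of an affine function it is the sum of the outer
  normal derivatives.\<close>

definition divergence :: "('e \<Rightarrow> real) \<Rightarrow> 'v \<Rightarrow> real" where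
  "divergence c w = (\<Sum>e\<in>arcs G. inc w e * c e)"

definition half_length :: "'v \<Rightarrow> real" where
  "half_length w = (\<Sum>e\<in>arcs G. ends w e * (len e / 2))"

text \<open>Vertex values of the torsion function; the weights \<open>half_length\<close> come from
  the slopes \<open>\<plusminus>len e / 2\<close> of the particular solution \<open>x * (len e - x) / 2\<close>.\<close>

definition torsion_vertex_values :: "'v set \<Rightarrow> ('v \<Rightarrow> real) \<Rightarrow> bool" where
  "torsion_vertex_values VD u \<longleftrightarrow> (\<forall>w\<in>VD. u w = 0) \<and>
     (\<forall>w\<in>verts G - VD. divergence (\<lambda>e. jump u e / len e) w = half_length w)"

lemma sum_inc: "e \<in> arcs G \<Longrightarrow> (\<Sum>w\<in>verts G. u w * inc w e) = jump u e"
  by (simp add: inc_def jump_def right_diff_distrib sum_subtractf sum_mult_of_bool_eq)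

lemma sum_ends:
  "e \<in> arcs G \<Longrightarrow> (\<Sum>w\<in>verts G. u w * ends w e) = u (head G e) + u (tail G e)"
  by (simp add: ends_def distrib_left sum.distrib sum_mult_of_bool_eq)

lemma green: "(\<Sum>w\<in>verts G. u w * divergence c w) = (\<Sum>e\<in>arcs G. c e * jump u e)"
proof -
  have "(\<Sum>w\<in>verts G. u w * divergence c w) = (\<Sum>e\<in>arcs G. \<Sum>w\<in>verts G. c e * (u w * inc w e))"
    unfolding divergence_def sum_distrib_left by (subst sum.swap) (simp add: mult_ac)
  also have "\<dots> = (\<Sum>e\<in>arcs G. c e * jump u e)"
    by (intro sum.cong refl) (simp add: sum_inc flip: sum_distrib_left)
  finally show ?thesis .
qed

text \<open>The bridge from topological to combinatorial connectedness: if no arc joins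
  \<open>S\<close> to its complement, every edge lies over one side, and the two sides are disjoint
  open sets covering the space.\<close>

lemma vertex_set_connected:
  assumes "S \<noteq> {}" "S \<subseteq> verts G"
    and closed: "\<And>e. e \<in> arcs G \<Longrightarrow> tail G e \<in> S \<longleftrightarrow> head G e \<in> S"
  shows "S = verts G"
proof (rule ccontr)
  assume "S \<noteq> verts G"
  \<comment> \<open>Inner points follow the tail of their edge; the choice of end is immaterial
    since both ends lie on the same side.\<close>
  define part where "part T = {p \<in> mg_points G len.
    case p of Vertex w \<Rightarrow> w \<in> T | Inner e x \<Rightarrow> tail G e \<in> T}" for T
  have ep: "edge_point G len e x \<in> part T \<longleftrightarrow> tail G e \<in> T"
    if "e \<in> arcs G" "x \<in> {0..len e}" "tail G e \<in> T \<longleftrightarrow> head G e \<in> T" for e x T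
  proof -
    have "edge_point G len e x \<in> mg_points G len"
      using that unfolding mg_points_def by blast
    then show ?thesis using that by (auto simp: part_def edge_point_def)
  qed
  have opn: "openin (mg_topology G len) (part T)"
    if T: "\<And>e. e \<in> arcs G \<Longrightarrow> tail G e \<in> T \<longleftrightarrow> head G e \<in> T" for T
    unfolding openin_mg_topology
  proof (intro conjI ballI)
    show "part T \<subseteq> mg_points G len" by (auto simp: part_def)
    fix e assume e: "e \<in> arcs G"
    have "{x \<in> {0..len e}. edge_point G len e x \<in> part T} = (if tail G e \<in> T then {0..len e} else {})"
      using ep[OF e _ T[OF e]] by auto
    then show "openin (top_of_set {0..len e}) {x \<in> {0..len e}. edge_point G len e x \<in> part T}"
      by simp
  qed
  have V: "verts G - S \<noteq> {}" using assms(2) \<open>S \<noteq> verts G\<close> by blast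
  have vp: "Vertex w \<in> part T" if "w \<in> verts G" "w \<in> T" for w T
    using that by (auto simp: part_def mg_points_def)
  have "mg_points G len \<subseteq> part S \<union> part (- S)"
  proof
    fix p assume "p \<in> mg_points G len"
    then show "p \<in> part S \<union> part (- S)" by (cases p) (simp_all add: part_def)
  qed
  then have cover: "topspace (mg_topology G len) \<subseteq> part S \<union> part (- S)"
    by (simp only: topspace_mg_topology)
  have "p \<notin> part (- S)" if "p \<in> part S" for p
    using that by (cases p) (simp_all add: part_def)
  then have disj: "part S \<inter> part (- S) = {}" by blast
  have ne: "part S \<noteq> {}" "part (- S) \<noteq> {}"
    using assms(1,2) V vp by blast+
  have "openin (mg_topology G len) (part S)" "openin (mg_topology G len) (part (- S))"
    using closed by (simp_all add: opn)
  from connected_spaceD[OF connected_mg this cover disj ne] show False .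
qed

text \<open>A vertex without incident arcs would be the whole vertex set by connectedness, yet some
  arc exists.\<close>

lemma half_length_pos:
  assumes "w \<in> verts G"
  shows "half_length w > 0"
proof -
  have "\<exists>e\<in>arcs G. head G e = w \<or> tail G e = w"
  proof (rule ccontr)
    assume no: "\<not> ?thesis"
    then have "{w} = verts G" using assms by (intro vertex_set_connected) auto
    then show False using no arcs_nonempty head_in_verts by blast
  qed
  then obtain e where e: "e \<in> arcs G" "head G e = w \<or> tail G e = w" by blast
  have "0 < ends w e * (len e / 2)" using e len_pos[OF e(1)] by (auto simp: ends_def)
  moreover have "0 \<le> ends w e * (len e / 2)" if "e \<in> arcs G" for e
    using len_pos[OF that] by (simp add: ends_def)
  ultimately show ?thesis unfolding half_length_def using e(1) by (intro sum_pos2) auto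
qed

text \<open>Testing the equation with \<open>u\<close> itself gives zero energy, so \<open>u\<close>
  does not change along any arc, and its zero set, which contains \<open>VD\<close>, spreads over
  the connected graph.\<close>

lemma harmonic_eq_0:
  assumes VD: "VD \<noteq> {}" "VD \<subseteq> verts G" "\<And>w. w \<in> VD \<Longrightarrow> u w = 0"
    and harm: "\<And>w. w \<in> verts G - VD \<Longrightarrow> divergence (\<lambda>e. jump u e / len e) w = 0"
    and w: "w \<in> verts G"
  shows "u w = 0"
proof -
  have "(\<Sum>e\<in>arcs G. jump u e / len e * jump u e) = 0"
    unfolding green[symmetric]
  proof (intro sum.neutral ballI)
    fix w assume "w \<in> verts G"
    then show "u w * divergence (\<lambda>e. jump u e / len e) w = 0"
      using VD(3) harm by (cases "w \<in> VD") auto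
  qed
  moreover have "0 \<le> jump u e / len e * jump u e" if "e \<in> arcs G" for e
    using len_pos[OF that] by simp
  ultimately have "jump u e / len e * jump u e = 0" if "e \<in> arcs G" for e
    using that by (simp add: sum_nonneg_eq_0_iff)
  then have j: "jump u e = 0" if "e \<in> arcs G" for e
    using that len_pos[OF that] by fastforce
  have "{w \<in> verts G. u w = 0} = verts G"
    using VD j by (intro vertex_set_connected) (auto simp: jump_def head_in_verts tail_in_verts)
  then show ?thesis using w by blast
qed

lemma torsion_vertex_values_unique:
  assumes VD: "VD \<noteq> {}" "VD \<subseteq> verts G"
    and u: "torsion_vertex_values VD u" "torsion_vertex_values VD u'"
    and w: "w \<in> verts G"
  shows "u w = u' w"
proof -
  have "inc w e * (jump (\<lambda>w. u w - u' w) e / len e) =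
      inc w e * (jump u e / len e) - inc w e * (jump u' e / len e)" for w e
    by (simp add: jump_def divide_inverse algebra_simps)
  then have diff: "divergence (\<lambda>e. jump (\<lambda>w. u w - u' w) e / len e) w =
      divergence (\<lambda>e. jump u e / len e) w - divergence (\<lambda>e. jump u' e / len e) w" for w
    by (simp only: divergence_def sum_subtractf)
  have "u w - u' w = 0"
  proof (rule harmonic_eq_0[OF VD _ _ w])
    show "u w - u' w = 0" if "w \<in> VD" for w
      using u that by (simp add: torsion_vertex_values_def)
    show "divergence (\<lambda>e. jump (\<lambda>w. u w - u' w) e / len e) w = 0" if "w \<in> verts G - VD" for w
      unfolding diff using u that by (simp add: torsion_vertex_values_def)
  qed
  then show ?thesis by simp
qed

lemma torsion_vertex_values_exist:
  assumes VD: "VD \<noteq> {}" "VD \<subseteq> verts G"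
  obtains u where "torsion_vertex_values VD u"
proof -
  define S where "S = verts G - VD"
  have S: "finite S" "S \<subseteq> verts G" by (auto simp: S_def)
  define A where "A i j = (\<Sum>e\<in>arcs G. inc i e * inc j e / len e)" for i j
  \<comment> \<open>The unknowns live on the vertices outside \<open>VD\<close>. With extension by 0
    the matrix \<open>A\<close> is the Dirichlet Laplacian; if no vertex lies outside
    \<open>VD\<close>, the system is empty.\<close>
  define ext :: "('v \<Rightarrow> real) \<Rightarrow> 'v \<Rightarrow> real" where "ext u w = (if w \<in> S then u w else 0)" for u w
  have lap: "(\<Sum>j\<in>S. A i j * u j) = divergence (\<lambda>e. jump (ext u) e / len e) i" for u i
  proof -
    have "(\<Sum>j\<in>S. A i j * u j) = (\<Sum>j\<in>verts G. A i j * ext u j)"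
      using S by (intro sum.mono_neutral_cong_left) (auto simp: ext_def)
    also have "\<dots> = (\<Sum>e\<in>arcs G. \<Sum>j\<in>verts G. inc i e / len e * (ext u j * inc j e))"
      unfolding A_def sum_distrib_right by (subst sum.swap) (simp add: mult_ac)
    also have "\<dots> = divergence (\<lambda>e. jump (ext u) e / len e) i"
      unfolding divergence_def
      by (intro sum.cong refl, subst sum_distrib_left[symmetric]) (simp add: sum_inc)
    finally show ?thesis .
  qed
  have "\<exists>u. \<forall>i\<in>S. (\<Sum>j\<in>S. A i j * u j) = half_length i"
  proof (rule square_linear_system_solvable[OF S(1)])
    fix u assume *: "\<And>i. i \<in> S \<Longrightarrow> (\<Sum>j\<in>S. A i j * u j) = 0"
    have "ext u w = 0" if "w \<in> verts G" for w
    proof (rule harmonic_eq_0[OF VD _ _ that])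
      show "ext u w = 0" if "w \<in> VD" for w using that by (simp add: ext_def S_def)
      show "divergence (\<lambda>e. jump (ext u) e / len e) w = 0" if "w \<in> verts G - VD" for w
        using *[of w] that by (simp add: lap, simp add: S_def)
    qed
    then show "\<forall>j\<in>S. u j = 0" using S(2) by (metis ext_def subsetD)
  qed
  then obtain u where u: "\<And>i. i \<in> S \<Longrightarrow> (\<Sum>j\<in>S. A i j * u j) = half_length i"
    by blast
  have "torsion_vertex_values VD (ext u)"
    using u unfolding torsion_vertex_values_def lap by (simp add: S_def, simp add: ext_def S_def)
  then show thesis by (rule that)
qed

text \<open>At a minimizing vertex every arc contributes a nonpositive amount to the divergence,
  which must equal the strictly positive \<open>half_length\<close> off \<open>VD\<close>.
  Strictness gives the contradiction at once, without following the minimum through the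
  graph.\<close>

lemma torsion_vertex_values_nonneg:
  assumes VD: "VD \<noteq> {}" "VD \<subseteq> verts G"
    and u: "torsion_vertex_values VD u" and w: "w \<in> verts G"
  shows "0 \<le> u w"
proof (rule ccontr)
  assume neg: "\<not> 0 \<le> u w"
  define z where "z = arg_min_on u (verts G)"
  have ne: "verts G \<noteq> {}" using w by blast
  have z: "z \<in> verts G" and min: "\<And>y. y \<in> verts G \<Longrightarrow> u z \<le> u y"
    using arg_min_if_finite(1)[OF finite_verts ne] arg_min_least[OF finite_verts ne] 
    unfolding z_def by auto
  have "u z < 0" using min[OF w] neg by simp
  then have "z \<notin> VD" using u by (auto simp: torsion_vertex_values_def)
  then have "divergence (\<lambda>e. jump u e / len e) z > 0"
    using u z half_length_pos[OF z] by (auto simp: torsion_vertex_values_def)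
  moreover have "divergence (\<lambda>e. jump u e / len e) z \<le> 0"
    unfolding divergence_def
  proof (rule sum_nonpos)
    fix e assume e: "e \<in> arcs G"
    show "inc z e * (jump u e / len e) \<le> 0"
      using len_pos[OF e] min[OF head_in_verts[OF e]] min[OF tail_in_verts[OF e]]
      by (auto simp: inc_def jump_def divide_le_0_iff)
  qed
  ultimately show False by simp
qed

text \<open>As \<open>u\<close> vanishes on \<open>VD\<close>, pairing a flow with
  \<open>jump u\<close> sees only its divergence off \<open>VD\<close>. Hence \<open>c\<close> and
  the gradient flow of \<open>u\<close> give the same value \<open>D\<close>, and completing the
  square on each arc compares the energies.\<close>

lemma thomson:
  assumes VD: "VD \<noteq> {}" "VD \<subseteq> verts G"
    and u: "torsion_vertex_values VD u"
    and c: "\<And>w. w \<in> verts G - VD \<Longrightarrow> divergence c w = half_length w"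
  shows "(\<Sum>w\<in>verts G. u w * half_length w) \<le> (\<Sum>e\<in>arcs G. len e * (c e)\<^sup>2)"
proof -
  define D where "D = (\<Sum>w\<in>verts G. u w * half_length w)"
  have eq: "D = (\<Sum>e\<in>arcs G. c' e * jump u e)"
    if "\<And>w. w \<in> verts G - VD \<Longrightarrow> divergence c' w = half_length w" for c'
  proof -
    have "D = (\<Sum>w\<in>verts G. u w * divergence c' w)"
      unfolding D_def
    proof (intro sum.cong refl)
      fix w assume "w \<in> verts G"
      then show "u w * half_length w = u w * divergence c' w"
        using that[of w] u by (cases "w \<in> VD") (auto simp: torsion_vertex_values_def)
    qed
    then show ?thesis by (simp add: green)
  qed
  have D1: "D = (\<Sum>e\<in>arcs G. jump u e / len e * jump u e)"
    using u by (intro eq) (auto simp: torsion_vertex_values_def)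
  have D2: "D = (\<Sum>e\<in>arcs G. c e * jump u e)" using c by (rule eq)
  have "2 * D \<le> (\<Sum>e\<in>arcs G. len e * (c e)\<^sup>2) + D"
  proof -
    have "2 * D = (\<Sum>e\<in>arcs G. 2 * (c e * jump u e))" by (simp add: D2 sum_distrib_left)
    also have "\<dots> \<le> (\<Sum>e\<in>arcs G. len e * (c e)\<^sup>2 + jump u e / len e * jump u e)"
    proof (rule sum_mono)
      fix e assume "e \<in> arcs G"
      then have l: "len e > 0" by (rule len_pos)
      have "len e * (c e)\<^sup>2 + jump u e / len e * jump u e - 2 * (c e * jump u e) =
          (len e * c e - jump u e)\<^sup>2 / len e"
        using l by (simp add: field_simps power2_eq_square)
      also have "\<dots> \<ge> 0" using l by simp
      finally show "2 * (c e * jump u e) \<le> len e * (c e)\<^sup>2 + jump u e / len e * jump u e" by simp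
    qed
    also have "\<dots> = (\<Sum>e\<in>arcs G. len e * (c e)\<^sup>2) + D" by (simp add: D1 sum.distrib)
    finally show ?thesis .
  qed
  then show ?thesis by (simp add: D_def)
qed

subsection \<open>Flows along a spanning forest\<close>

text \<open>The arcs \<open>A\<close> play the part of a forest spanning \<open>S\<close> and rooted at \<open>VD\<close>, along which every mass
  distribution \<open>m\<close> on \<open>S\<close>, together with the lengths of the forest itself, can be transported to the
  roots. On an arc that carries the mass \<open>a\<close> at its far end, the flow at distance \<open>x\<close> from there is
  \<open>a + x\<close>, with midpoint value \<open>c e\<close>, and its energy
  \<open>len e * (c e)\<^sup>2 + len e ^ 3 / 12 = ((a + len e) ^ 3 - a ^ 3) / 3\<close> telescopes along the forest.\<close>

definition spanning_flow :: "'v set \<Rightarrow> 'v set \<Rightarrow> 'e set \<Rightarrow> bool" where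
  "spanning_flow VD S A \<longleftrightarrow> A \<subseteq> arcs G \<and> (\<forall>e\<in>A. tail G e \<in> S \<and> head G e \<in> S) \<and>
     (\<forall>m. (\<forall>w. 0 \<le> m w) \<longrightarrow> (\<exists>c. (\<forall>e. e \<notin> A \<longrightarrow> c e = 0) \<and>
        (\<forall>w\<in>S - VD. divergence c w = m w + (\<Sum>e\<in>A. ends w e * (len e / 2))) \<and>
        (\<Sum>e\<in>A. len e * (c e)\<^sup>2 + len e ^ 3 / 12) + (\<Sum>w\<in>S. m w ^ 3 / 3)
          \<le> ((\<Sum>w\<in>S. m w) + (\<Sum>e\<in>A. len e)) ^ 3 / 3))"

lemma spanning_flowE:
  assumes "spanning_flow VD S A" and "\<And>w. 0 \<le> m w"
  obtains c where "\<And>e. e \<notin> A \<Longrightarrow> c e = 0"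
    and "\<And>w. w \<in> S - VD \<Longrightarrow> divergence c w = m w + (\<Sum>e\<in>A. ends w e * (len e / 2))"
    and "(\<Sum>e\<in>A. len e * (c e)\<^sup>2 + len e ^ 3 / 12) + (\<Sum>w\<in>S. m w ^ 3 / 3)
      \<le> ((\<Sum>w\<in>S. m w) + (\<Sum>e\<in>A. len e)) ^ 3 / 3"
proof -
  from assms(1) have "\<forall>m. (\<forall>w. 0 \<le> m w) \<longrightarrow> (\<exists>c. (\<forall>e. e \<notin> A \<longrightarrow> c e = 0) \<and>
        (\<forall>w\<in>S - VD. divergence c w = m w + (\<Sum>e\<in>A. ends w e * (len e / 2))) \<and>
        (\<Sum>e\<in>A. len e * (c e)\<^sup>2 + len e ^ 3 / 12) + (\<Sum>w\<in>S. m w ^ 3 / 3)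
          \<le> ((\<Sum>w\<in>S. m w) + (\<Sum>e\<in>A. len e)) ^ 3 / 3)"
    unfolding spanning_flow_def by (elim conjE)
  then obtain c where "\<forall>e. e \<notin> A \<longrightarrow> c e = 0"
    and "\<forall>w\<in>S - VD. divergence c w = m w + (\<Sum>e\<in>A. ends w e * (len e / 2))"
    and "(\<Sum>e\<in>A. len e * (c e)\<^sup>2 + len e ^ 3 / 12) + (\<Sum>w\<in>S. m w ^ 3 / 3)
      \<le> ((\<Sum>w\<in>S. m w) + (\<Sum>e\<in>A. len e)) ^ 3 / 3"
    using assms(2) by meson
  then show thesis by (intro that[of c]) simp_all
qed

text \<open>The zero flow works: there is no vertex at which a divergence is prescribed, and the
  cost estimate is superadditivity of the cube.\<close>

lemma spanning_flow_roots:
  "spanning_flow VD VD {}"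
  unfolding spanning_flow_def
proof (intro conjI allI impI)
  fix m :: "'v \<Rightarrow> real" assume "\<forall>w. 0 \<le> m w"
  then have "(\<Sum>w\<in>VD. m w ^ 3) \<le> (\<Sum>w\<in>VD. m w) ^ 3"
    by (intro sum_cubes_le_cube_sum) auto
  then show "\<exists>c. (\<forall>e. e \<notin> {} \<longrightarrow> c e = 0) \<and>
        (\<forall>w\<in>VD - VD. divergence c w = m w + (\<Sum>e\<in>{}. ends w e * (len e / 2))) \<and>
        (\<Sum>e\<in>{}. len e * (c e)\<^sup>2 + len e ^ 3 / 12) + (\<Sum>w\<in>VD. m w ^ 3 / 3)
          \<le> ((\<Sum>w\<in>VD. m w) + (\<Sum>e\<in>{}. len e)) ^ 3 / 3"
    by (intro exI[of _ "\<lambda>_. 0"]) (simp flip: sum_divide_distrib)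
qed auto

text \<open>A new leaf \<open>w\<close> is folded into its neighbour \<open>s\<close>: the old flow
  is taken for the distribution in which \<open>s\<close> also holds the mass of \<open>w\<close>
  and the length of the new arc. This is why the notion quantifies over all mass
  distributions.\<close>

lemma spanning_flow_extend:
  assumes flow: "spanning_flow VD S A"
    and S: "VD \<subseteq> S" "S \<subseteq> verts G"
    and e: "e \<in> arcs G" and s: "s \<in> S" and w: "w \<notin> S"
    and ends_e: "tail G e = s \<and> head G e = w \<or> tail G e = w \<and> head G e = s"
  shows "spanning_flow VD (insert w S) (insert e A)"
proof -
  have A: "A \<subseteq> arcs G" "\<And>e. e \<in> A \<Longrightarrow> tail G e \<in> S \<and> head G e \<in> S"
    using flow by (auto simp: spanning_flow_def)
  have fin: "finite A" "finite S" using A(1) S(2) by (auto intro: finite_subset)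
  have eA: "e \<notin> A" using A(2) ends_e w by blast
  have sw: "s \<noteq> w" using s w by blast
  have inc_s: "inc s e = - inc w e" and inc_w: "(inc w e)\<^sup>2 = 1"
    using ends_e sw by (auto simp: inc_def)
  have inc_inc: "inc w e * (inc w e * x) = x" for x
    using inc_w by (simp add: power2_eq_square flip: mult.assoc)
  have inc_0: "inc z e = 0" "ends z e = 0" if "z \<noteq> s" "z \<noteq> w" for z
    using ends_e that by (auto simp: inc_def ends_def)
  have ends_1: "ends s e = 1" "ends w e = 1"
    using ends_e sw by (auto simp: ends_def)
  have w_0: "inc w a = 0" "ends w a = 0" if "a \<in> A" for a
    using A(2)[OF that] w by (auto simp: inc_def ends_def)
  have l: "len e > 0" using e by (rule len_pos)
  show ?thesis
    unfolding spanning_flow_def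
  proof (intro conjI allI impI)
    show "insert e A \<subseteq> arcs G" using e A by blast
    show "\<forall>a\<in>insert e A. tail G a \<in> insert w S \<and> head G a \<in> insert w S"
      using A(2) ends_e s by auto
    fix m :: "'v \<Rightarrow> real" assume m: "\<forall>w. 0 \<le> m w"
    define m' where "m' = m(s := m s + (m w + len e))"
    have "0 \<le> m' w" for w using m l by (simp add: m'_def add_nonneg_nonneg)
    then obtain c where c0: "\<And>a. a \<notin> A \<Longrightarrow> c a = 0"
      and div_c: "\<And>z. z \<in> S - VD \<Longrightarrow> divergence c z = m' z + (\<Sum>a\<in>A. ends z a * (len a / 2))"
      and cost: "(\<Sum>a\<in>A. len a * (c a)\<^sup>2 + len a ^ 3 / 12) + (\<Sum>z\<in>S. m' z ^ 3 / 3)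
          \<le> ((\<Sum>z\<in>S. m' z) + (\<Sum>a\<in>A. len a)) ^ 3 / 3"
      using spanning_flowE[OF flow] by blast
    \<comment> \<open>The factor \<open>inc w e\<close> orients the flow so that \<open>w\<close>
      gets inflow \<open>m w + len e / 2\<close>. The same amount is taken from \<open>s\<close>,
      whose surplus in \<open>m'\<close> is \<open>m w + len e\<close>, so \<open>s\<close> keeps
      exactly its half of the new arc.\<close>
    define c' where "c' = c(e := inc w e * (m w + len e / 2))"
    have c'_A: "c' a = c a" if "a \<in> A" for a using that eA by (auto simp: c'_def)
    have div_c': "divergence c' z = divergence c z + inc z e * (inc w e * (m w + len e / 2))" for z
    proof -
      have "divergence c' z = (\<Sum>a\<in>arcs G. inc z a * c a +
          (if a = e then inc z e * (inc w e * (m w + len e / 2)) else 0))"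
        unfolding divergence_def using c0[OF eA] by (intro sum.cong) (auto simp: c'_def)
      then show ?thesis using e by (simp add: divergence_def sum.distrib)
    qed
    have "divergence c w = 0"
      unfolding divergence_def using c0 w_0 
    by (intro sum.neutral ballI) (simp, blast)
    then have div_w: "divergence c' w = m w + len e / 2"
      by (simp add: div_c' inc_inc)
    have div_s: "divergence c' s = m s + len e / 2 + (\<Sum>a\<in>A. ends s a * (len a / 2))" if "s \<notin> VD"
      using div_c[of s] s that by (simp add: div_c' inc_s inc_inc m'_def)
    have "divergence c' z = m z + (\<Sum>a\<in>insert e A. ends z a * (len a / 2))"
      if z: "z \<in> insert w S - VD" for z
    proof -
      consider "z = w" | "z = s" | "z \<noteq> w" "z \<noteq> s" by blast
      then show ?thesis
      proof cases
        case 1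
        then show ?thesis using div_w fin eA w_0 by (simp add: ends_1)
      next
        case 2
        then show ?thesis using div_s z fin eA by (simp add: ends_1)
      next
        case 3
        then show ?thesis using div_c[of z] z fin eA inc_0[of z] by (simp add: div_c' m'_def)
      qed
    qed
    moreover have "(\<Sum>a\<in>insert e A. len a * (c' a)\<^sup>2 + len a ^ 3 / 12) + (\<Sum>z\<in>insert w S. m z ^ 3 / 3)
          \<le> ((\<Sum>z\<in>insert w S. m z) + (\<Sum>a\<in>insert e A. len a)) ^ 3 / 3"
    proof -
      have "(c' e)\<^sup>2 = (m w + len e / 2)\<^sup>2"
        by (simp add: c'_def power_mult_distrib inc_w)
      then have e_cost: "len e * (c' e)\<^sup>2 + len e ^ 3 / 12 = ((m w + len e) ^ 3 - m w ^ 3) / 3"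
        by (simp only:) (simp add: power2_eq_square power3_eq_cube field_simps)
      have split: "(\<Sum>z\<in>S. f z) = f s + (\<Sum>z\<in>S - {s}. f z)" for f :: "'v \<Rightarrow> real"
        using fin s by (simp add: sum.remove)
      have m'_sum: "(\<Sum>z\<in>S. m' z) = (\<Sum>z\<in>S. m z) + (m w + len e)"
        unfolding split by (simp add: m'_def)
      \<comment> \<open>The two streams that merge at \<open>s\<close>: its own mass, and what
        arrives through the new arc.\<close>
      have "m s ^ 3 + (m w + len e) ^ 3 \<le> (m s + (m w + len e)) ^ 3"
        using m l by (intro cube_superadditive) (auto simp: add_nonneg_nonneg)
      then have m'_cost: "(\<Sum>z\<in>S. m z ^ 3 / 3) + (m w + len e) ^ 3 / 3 \<le> (\<Sum>z\<in>S. m' z ^ 3 / 3)"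
        unfolding split by (simp add: m'_def add_divide_distrib[symmetric])
      have "(\<Sum>a\<in>A. len a * (c' a)\<^sup>2 + len a ^ 3 / 12) = (\<Sum>a\<in>A. len a * (c a)\<^sup>2 + len a ^ 3 / 12)"
        by (intro sum.cong) (auto simp: c'_A)
      then show ?thesis
        using cost m'_cost e_cost fin eA w by (simp add: m'_sum add_ac diff_divide_distrib)
    qed
    moreover have "\<forall>a. a \<notin> insert e A \<longrightarrow> c' a = 0" using c0 by (simp add: c'_def)
    ultimately show "\<exists>c. (\<forall>a. a \<notin> insert e A \<longrightarrow> c a = 0) \<and>
        (\<forall>z\<in>insert w S - VD. divergence c z = m z + (\<Sum>a\<in>insert e A. ends z a * (len a / 2))) \<and>
        (\<Sum>a\<in>insert e A. len a * (c a)\<^sup>2 + len a ^ 3 / 12) + (\<Sum>z\<in>insert w S. m z ^ 3 / 3)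
          \<le> ((\<Sum>z\<in>insert w S. m z) + (\<Sum>a\<in>insert e A. len a)) ^ 3 / 3"
      by (intro exI[of _ c']) blast
  qed
qed

text \<open>A reachable set of greatest cardinality is left by no arc, since such an arc would
  extend it; connectedness then makes it the whole vertex set.\<close>

lemma spanning_flow_exists:
  assumes VD: "VD \<noteq> {}" "VD \<subseteq> verts G"
  obtains A where "spanning_flow VD (verts G) A"
proof -
  define P where "P S \<longleftrightarrow> VD \<subseteq> S \<and> S \<subseteq> verts G \<and> (\<exists>A. spanning_flow VD S A)" for S
  have "P VD" using VD spanning_flow_roots by (auto simp: P_def)
  moreover have "card S \<le> card (verts G)" if "P S" for S
    using that by (simp add: P_def card_mono)
  ultimately have "\<exists>S. P S \<and> (\<forall>T. P T \<longrightarrow> card T \<le> card S)"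
    by (intro ex_has_greatest_nat[of P VD card "Suc (card (verts G))"]) (simp_all add: less_Suc_eq_le)
  then obtain S where S: "P S" and max: "\<And>T. P T \<Longrightarrow> card T \<le> card S" by blast
  obtain A where A: "spanning_flow VD S A" using S by (auto simp: P_def)
  have sub: "VD \<subseteq> S" "S \<subseteq> verts G" using S by (auto simp: P_def)
  have "S = verts G"
  proof (rule vertex_set_connected)
    show "S \<noteq> {}" "S \<subseteq> verts G" using VD sub by auto
    fix e assume e: "e \<in> arcs G"
    have False if sw: "s \<in> S" "w \<notin> S" "w \<in> verts G"
      and ends_e: "tail G e = s \<and> head G e = w \<or> tail G e = w \<and> head G e = s" for s w
    proof -
      have "P (insert w S)"
        using spanning_flow_extend[OF A sub e sw(1,2) ends_e] sub sw(3) by (auto simp: P_def)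
      then have "card (insert w S) \<le> card S" by (rule max)
      then show False using sw(2) sub(2) by (simp add: finite_subset card_insert_disjoint)
    qed
    then show "tail G e \<in> S \<longleftrightarrow> head G e \<in> S"
      using head_in_verts[OF e] tail_in_verts[OF e] by blast
  qed
  then show thesis using A that by blast
qed

text \<open>Each cut arc leaves half of its length as mass at either end and carries midpoint value
  0, so only its \<open>len e ^ 3 / 12\<close> has to be paid for. The cubes of the masses in the
  flow estimate cover that.\<close>

lemma torsion_vertex_values_upper_bound:
  assumes VD: "VD \<noteq> {}" "VD \<subseteq> verts G" and u: "torsion_vertex_values VD u"
  shows "(\<Sum>w\<in>verts G. u w * half_length w) + (\<Sum>e\<in>arcs G. len e ^ 3 / 12)
    \<le> total_length G len ^ 3 / 3"
proof -
  obtain A where A: "spanning_flow VD (verts G) A" using spanning_flow_exists[OF VD] .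
  have "A \<subseteq> arcs G" using A by (simp add: spanning_flow_def)
  define R where "R = arcs G - A"
  have split: "(\<Sum>e\<in>arcs G. f e) = (\<Sum>e\<in>A. f e) + (\<Sum>e\<in>R. f e)" for f :: "'e \<Rightarrow> real"
    using \<open>A \<subseteq> arcs G\<close> 
    by (simp add: R_def sum.subset_diff[OF \<open>A \<subseteq> arcs G\<close>] add.commute)
  have R: "e \<in> arcs G" "0 \<le> len e" if "e \<in> R" for e
    using that len_pos by (auto simp: R_def less_imp_le)
  \<comment> \<open>The remaining arcs are cut at their midpoints.\<close>
  define m where "m w = (\<Sum>e\<in>R. ends w e * (len e / 2))" for w
  have ends_nonneg: "0 \<le> ends w e" for w e by (simp add: ends_def)
  have "0 \<le> m w" for w
    using R ends_nonneg unfolding m_def by (auto intro!: sum_nonneg mult_nonneg_nonneg)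
  then obtain c where c0: "\<And>e. e \<notin> A \<Longrightarrow> c e = 0"
    and div_c: "\<And>w. w \<in> verts G - VD \<Longrightarrow> divergence c w = m w + (\<Sum>e\<in>A. ends w e * (len e / 2))"
    and cost: "(\<Sum>e\<in>A. len e * (c e)\<^sup>2 + len e ^ 3 / 12) + (\<Sum>w\<in>verts G. m w ^ 3 / 3)
        \<le> ((\<Sum>w\<in>verts G. m w) + (\<Sum>e\<in>A. len e)) ^ 3 / 3"
    using spanning_flowE[OF A] by blast
  have "(\<Sum>w\<in>verts G. u w * half_length w) \<le> (\<Sum>e\<in>arcs G. len e * (c e)\<^sup>2)"
    using div_c by (intro thomson[OF VD u]) (simp add: half_length_def split m_def)
  also have "\<dots> = (\<Sum>e\<in>A. len e * (c e)\<^sup>2)"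
    unfolding split using c0 by (simp add: R_def)
  finally have energy: "(\<Sum>w\<in>verts G. u w * half_length w) \<le> (\<Sum>e\<in>A. len e * (c e)\<^sup>2)" .
  have sum_ends_1: "(\<Sum>w\<in>verts G. ends w e) = 2" if "e \<in> R" for e
    using sum_ends[OF R(1)[OF that], of "\<lambda>_. 1"] by simp
  have "(\<Sum>w\<in>verts G. m w) = (\<Sum>e\<in>R. \<Sum>w\<in>verts G. ends w e * (len e / 2))"
    unfolding m_def by (rule sum.swap)
  also have "\<dots> = (\<Sum>e\<in>R. len e)"
    by (intro sum.cong refl) (simp add: sum_ends_1 sum_distrib_right[symmetric] del: times_divide_eq_right)
  finally have mass: "(\<Sum>w\<in>verts G. m w) + (\<Sum>e\<in>A. len e) = total_length G len"
    by (simp add: total_length_def split)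
  \<comment> \<open>Two halves give 2 * (len e / 2)^3 = len e^3 / 4, and a third of this is the
    required twelfth.\<close>
  have "(\<Sum>e\<in>R. len e ^ 3 / 4) = (\<Sum>e\<in>R. \<Sum>w\<in>verts G. ends w e * (len e / 2) ^ 3)"
    by (intro sum.cong refl)
      (simp only: sum_ends_1 sum_distrib_right[symmetric], simp add: power_divide)
  \<comment> \<open>\<open>ends\<close> takes the values 0, 1 and 2 and is thus at most its cube;
    the inequality is strict only for loops, whose two halves meet at one vertex.\<close>
  also have "\<dots> \<le> (\<Sum>e\<in>R. \<Sum>w\<in>verts G. (ends w e * (len e / 2)) ^ 3)"
    unfolding power_mult_distrib using R(2)
    by (intro sum_mono mult_right_mono) (auto simp: ends_def)
  also have "\<dots> = (\<Sum>w\<in>verts G. \<Sum>e\<in>R. (ends w e * (len e / 2)) ^ 3)"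
    by (rule sum.swap)
  also have "\<dots> \<le> (\<Sum>w\<in>verts G. m w ^ 3)"
    unfolding m_def using R(2) ends_nonneg
    by (intro sum_mono sum_cubes_le_cube_sum) (auto intro!: mult_nonneg_nonneg)
  finally have "(\<Sum>e\<in>R. len e ^ 3 / 12) \<le> (\<Sum>w\<in>verts G. m w ^ 3 / 3)"
    by (simp flip: sum_divide_distrib)
  then show ?thesis using energy cost mass by (simp add: split sum.distrib)
qed

section \<open>The torsion function\<close>

lemma on_edge_ends:
  "on_edge G len v e 0 = v (Vertex (tail G e))"
  "e \<in> arcs G \<Longrightarrow> on_edge G len v e (len e) = v (Vertex (head G e))"
  using len_pos[of e] by (auto simp: on_edge_def edge_point_def)

definition has_edge_profiles :: "(('v, 'e) mg_point \<Rightarrow> real) \<Rightarrow> bool" where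
  "has_edge_profiles v \<longleftrightarrow> (\<forall>e\<in>arcs G. \<forall>x\<in>{0..len e}. on_edge G len v e x =
     edge_profile (len e) (v (Vertex (tail G e))) (v (Vertex (head G e))) x)"

lemma half_length_sum:
  "(\<Sum>w\<in>verts G. u w * half_length w) = (\<Sum>e\<in>arcs G. (u (tail G e) + u (head G e)) * (len e / 2))"
proof -
  have "(\<Sum>w\<in>verts G. u w * half_length w) =
      (\<Sum>e\<in>arcs G. \<Sum>w\<in>verts G. (u w * ends w e) * (len e / 2))"
    unfolding half_length_def sum_distrib_left by (subst sum.swap) (simp add: mult.assoc)
  also have "\<dots> = (\<Sum>e\<in>arcs G. (u (tail G e) + u (head G e)) * (len e / 2))"
    by (intro sum.cong refl) (simp only: sum_distrib_right[symmetric] sum_ends add.commute)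
  finally show ?thesis .
qed

lemma mg_integral_edge_profiles:
  assumes "has_edge_profiles v"
  shows "mg_integral G len v =
    (\<Sum>w\<in>verts G. v (Vertex w) * half_length w) + (\<Sum>e\<in>arcs G. len e ^ 3 / 12)"
proof -
  have "mg_integral G len v =
      (\<Sum>e\<in>arcs G. (v (Vertex (tail G e)) + v (Vertex (head G e))) * (len e / 2) + len e ^ 3 / 12)"
    unfolding mg_integral_def
  proof (intro sum.cong refl)
    fix e assume e: "e \<in> arcs G"
    have "(LINT x:{0..len e}|lborel. on_edge G len v e x) = (LINT x:{0..len e}|lborel.
        edge_profile (len e) (v (Vertex (tail G e))) (v (Vertex (head G e))) x)"
      using assms e by (intro set_lebesgue_integral_cong) (auto simp: has_edge_profiles_def)
    then show "(LINT x:{0..len e}|lborel. on_edge G len v e x) =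
        (v (Vertex (tail G e)) + v (Vertex (head G e))) * (len e / 2) + len e ^ 3 / 12"
      by (simp only: LINT_edge_profile[OF len_pos[OF e]])
  qed
  then show ?thesis by (simp only: sum.distrib half_length_sum)
qed

text \<open>The affine slope enters with opposite signs at head and tail, while the parabola has
  outer derivative \<open>- len e / 2\<close> at both ends. A loop occurs in both sums, in agreement
  with \<open>inc\<close> = 0 and \<open>ends\<close> = 2.\<close>

lemma normal_deriv_sum_edge_profiles:
  assumes "has_edge_profiles v"
  shows "normal_deriv_sum G len v w =
    divergence (\<lambda>e. jump (\<lambda>w. v (Vertex w)) e / len e) w - half_length w"
proof -
  define s where "s e = jump (\<lambda>w. v (Vertex w)) e / len e" for e
  have deriv: "vector_derivative (on_edge G len v e) (at x within {0..len e}) = s e + len e / 2 - x"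
    if e: "e \<in> arcs G" and x: "x \<in> {0..len e}" for e x
  proof (rule vector_derivative_within_closed_interval[OF len_pos[OF e] x])
    have "(edge_profile (len e) (v (Vertex (tail G e))) (v (Vertex (head G e)))
        has_vector_derivative s e + len e / 2 - x) (at x within {0..len e})"
      using has_real_derivative_edge_profile unfolding s_def jump_def
        has_real_derivative_iff_has_vector_derivative by (rule has_vector_derivative_at_within)
    then show "(on_edge G len v e has_vector_derivative s e + len e / 2 - x) (at x within {0..len e})"
      by (rule has_vector_derivative_transform[OF x, rotated])
        (use assms e in \<open>simp add: has_edge_profiles_def\<close>)
  qed
  have "normal_deriv_sum G len v w =
      (\<Sum>e | e \<in> arcs G \<and> tail G e = w. - (s e + len e / 2)) +
      (\<Sum>e | e \<in> arcs G \<and> head G e = w. s e - len e / 2)"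
    unfolding normal_deriv_sum_def
    using len_pos by (intro arg_cong2[where f = "(+)"] sum.cong refl) (auto simp: deriv less_imp_le)
  also have "\<dots> = (\<Sum>e\<in>arcs G. (if tail G e = w then - (s e + len e / 2) else 0) +
      (if head G e = w then s e - len e / 2 else 0))"
    by (simp only: sum.inter_filter[OF finite_arcs] sum.distrib)
  also have "\<dots> = (\<Sum>e\<in>arcs G. inc w e * s e - ends w e * (len e / 2))"
    by (intro sum.cong refl) (simp add: inc_def ends_def)
  also have "\<dots> = divergence s w - half_length w"
    by (simp add: divergence_def half_length_def sum_subtractf)
  finally show ?thesis by (simp add: s_def[abs_def])
qed

text \<open>The reduction to finite dimension: continuity and the weak equation amount to the edge
  profiles, and for these the Dirichlet and Kirchhoff conditions become the discrete system.\<close>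

lemma is_torsion_function_iff:
  "is_torsion_function G len VD v \<longleftrightarrow> v \<in> extensional (mg_points G len) \<and>
     has_edge_profiles v \<and> torsion_vertex_values VD (\<lambda>w. v (Vertex w))"
proof -
  have kirchhoff: "(\<forall>w\<in>VD. v (Vertex w) = 0) \<and> (\<forall>w\<in>verts G - VD. normal_deriv_sum G len v w = 0) \<longleftrightarrow>
      torsion_vertex_values VD (\<lambda>w. v (Vertex w))" if "has_edge_profiles v"
    using normal_deriv_sum_edge_profiles[OF that] by (simp add: torsion_vertex_values_def)
  have "continuous_map (mg_topology G len) euclideanreal v \<and>
     (\<forall>e\<in>arcs G. \<exists>h. H2_with (len e) (on_edge G len v e) h \<and>
        (AE x in lborel. x \<in> {0<..<len e} \<longrightarrow> - h x = 1)) \<longleftrightarrow> has_edge_profiles v"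
    (is "?C \<and> ?H \<longleftrightarrow> _")
  proof (intro iffI conjI)
    assume CH: "?C \<and> ?H"
    show "has_edge_profiles v"
      unfolding has_edge_profiles_def
    proof (intro ballI)
      fix e x assume e: "e \<in> arcs G" and x: "x \<in> {0..len e}"
      obtain h where h: "H2_with (len e) (on_edge G len v e) h"
          "AE x in lborel. x \<in> {0<..<len e} \<longrightarrow> - h x = 1"
        using CH e by blast
      have "continuous_on {0..len e} (on_edge G len v e)"
        using CH e by (simp add: continuous_map_mg_topology_iff)
      from H2_with_eq_edge_profile[OF len_pos[OF e] this h x]
      show "on_edge G len v e x = edge_profile (len e) (v (Vertex (tail G e))) (v (Vertex (head G e))) x"
        by (simp only: on_edge_ends(1) on_edge_ends(2)[OF e])
    qed
  next
    assume P: "has_edge_profiles v"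
    show ?C
      unfolding continuous_map_mg_topology_iff
    proof
      fix e assume e: "e \<in> arcs G"
      show "continuous_on {0..len e} (on_edge G len v e)"
        using P e by (intro continuous_on_eq[OF continuous_on_edge_profile])
          (simp add: has_edge_profiles_def)
    qed
    show ?H
    proof
      fix e assume e: "e \<in> arcs G"
      have "H2_with (len e) (on_edge G len v e) (\<lambda>x. - 1)"
        using P e by (intro H2_with_edge_profile[OF len_pos[OF e]]) (simp add: has_edge_profiles_def)
      then show "\<exists>h. H2_with (len e) (on_edge G len v e) h \<and>
          (AE x in lborel. x \<in> {0<..<len e} \<longrightarrow> - h x = 1)"
        by (intro exI[of _ "\<lambda>x. - 1"]) simp
    qed
  qed
  then show ?thesis unfolding is_torsion_function_def using kirchhoff by blast
qed

lemma torsion_function_exists: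
  assumes VD: "VD \<noteq> {}" "VD \<subseteq> verts G"
  shows "\<exists>v. is_torsion_function G len VD v"
proof -
  obtain u where u: "torsion_vertex_values VD u" using torsion_vertex_values_exist[OF VD] .
  define v where "v = restrict (case_mg_point u
    (\<lambda>e. edge_profile (len e) (u (tail G e)) (u (head G e)))) (mg_points G len)"
  have v_Vertex: "v (Vertex w) = u w" if "w \<in> verts G" for w
    using that by (simp add: v_def mg_points_def)
  have "has_edge_profiles v"
    unfolding has_edge_profiles_def
  proof (intro ballI)
    fix e x assume e: "e \<in> arcs G" and x: "x \<in> {0..len e}"
    have "on_edge G len v e x = edge_profile (len e) (u (tail G e)) (u (head G e)) x"
      using edge_point_in_mg_points[of e G x len, OF e x] len_pos[OF e]
      by (auto simp: on_edge_def v_def edge_point_def)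
    then show "on_edge G len v e x = edge_profile (len e) (v (Vertex (tail G e))) (v (Vertex (head G e))) x"
      using e by (simp add: v_Vertex)
  qed
  moreover have "torsion_vertex_values VD (\<lambda>w. v (Vertex w))"
  proof -
    have "divergence (\<lambda>e. jump (\<lambda>w. v (Vertex w)) e / len e) w = divergence (\<lambda>e. jump u e / len e) w" for w
      unfolding divergence_def by (intro sum.cong refl) (simp add: jump_def v_Vertex)
    then show ?thesis
      using u VD(2) by (auto simp: torsion_vertex_values_def v_Vertex subset_iff)
  qed
  moreover have "v \<in> extensional (mg_points G len)" by (simp add: v_def)
  ultimately show ?thesis unfolding is_torsion_function_iff by blast
qed

lemma torsion_function_unique:
  assumes VD: "VD \<noteq> {}" "VD \<subseteq> verts G"
    and v: "is_torsion_function G len VD v" "is_torsion_function G len VD v'"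
  shows "v = v'"
proof (rule extensionalityI[where A = "mg_points G len"])
  show "v \<in> extensional (mg_points G len)" "v' \<in> extensional (mg_points G len)"
    using v by (auto simp: is_torsion_function_iff)
  have eq: "v (Vertex w) = v' (Vertex w)" if "w \<in> verts G" for w
    using torsion_vertex_values_unique[OF VD _ _ that] v unfolding is_torsion_function_iff by blast
  fix p assume "p \<in> mg_points G len"
  then consider w where "p = Vertex w" "w \<in> verts G"
    | e x where "e \<in> arcs G" "x \<in> {0..len e}" "p = edge_point G len e x"
    unfolding mg_points_def by blast
  then show "v p = v' p"
  proof cases
    case 1
    then show ?thesis by (simp add: eq)
  next
    case 2
    then have "on_edge G len v e x = on_edge G len v' e x"
      using v by (simp add: is_torsion_function_iff has_edge_profiles_def eq)
    then show ?thesis by (simp add: on_edge_def 2)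
  qed
qed

lemma is_torsion_function_torsion_function:
  assumes VD: "VD \<noteq> {}" "VD \<subseteq> verts G"
  shows "is_torsion_function G len VD (torsion_function G len VD)"
  unfolding torsion_function_def
  using torsion_function_exists[OF VD] torsion_function_unique[OF VD] by (metis theI)

section \<open>The two bounds on the torsional rigidity\<close>

lemma torsional_rigidity_vertex_values:
  assumes VD: "VD \<noteq> {}" "VD \<subseteq> verts G"
  obtains u where "torsion_vertex_values VD u"
    and "torsional_rigidity G len VD =
      (\<Sum>w\<in>verts G. u w * half_length w) + (\<Sum>e\<in>arcs G. len e ^ 3 / 12)"
proof
  show "torsion_vertex_values VD (\<lambda>w. torsion_function G len VD (Vertex w))"
    using is_torsion_function_torsion_function[OF VD] by (simp add: is_torsion_function_iff)
  show "torsional_rigidity G len VD = (\<Sum>w\<in>verts G. torsion_function G len VD (Vertex w) * half_length w) +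
      (\<Sum>e\<in>arcs G. len e ^ 3 / 12)"
    unfolding torsional_rigidity_def using is_torsion_function_torsion_function[OF VD]
    by (intro mg_integral_edge_profiles) (simp add: is_torsion_function_iff)
qed

lemma torsional_rigidity_bounds:
  assumes VD: "VD \<noteq> {}" "VD \<subseteq> verts G"
  shows "total_length G len ^ 3 / (12 * (real (card (arcs G)))\<^sup>2) \<le> torsional_rigidity G len VD"
    and "torsional_rigidity G len VD \<le> total_length G len ^ 3 / 3"
proof -
  obtain u where u: "torsion_vertex_values VD u"
    and T: "torsional_rigidity G len VD =
      (\<Sum>w\<in>verts G. u w * half_length w) + (\<Sum>e\<in>arcs G. len e ^ 3 / 12)"
    using torsional_rigidity_vertex_values[OF VD] .
  show "torsional_rigidity G len VD \<le> total_length G len ^ 3 / 3"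
    using torsion_vertex_values_upper_bound[OF VD u] by (simp only: T)
  \<comment> \<open>Dropping this sum leaves the rigidity for Dirichlet conditions at all vertices,
    that is, for disjoint intervals.\<close>
  have "0 \<le> (\<Sum>w\<in>verts G. u w * half_length w)"
    using torsion_vertex_values_nonneg[OF VD u] half_length_pos
    by (intro sum_nonneg mult_nonneg_nonneg) (auto simp: less_imp_le)
  then have "(\<Sum>e\<in>arcs G. len e ^ 3) \<le> 12 * torsional_rigidity G len VD"
    by (simp add: T flip: sum_divide_distrib)
  then have "(real (card (arcs G)))\<^sup>2 * (\<Sum>e\<in>arcs G. len e ^ 3)
      \<le> (real (card (arcs G)))\<^sup>2 * (12 * torsional_rigidity G len VD)"
    by (intro mult_left_mono) auto
  moreover have "total_length G len ^ 3 \<le> (real (card (arcs G)))\<^sup>2 * (\<Sum>e\<in>arcs G. len e ^ 3)"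
    unfolding total_length_def using len_pos
    by (intro cube_sum_le_card_sq_sum_cubes) (auto simp: less_imp_le)
  ultimately have "total_length G len ^ 3
      \<le> torsional_rigidity G len VD * (12 * (real (card (arcs G)))\<^sup>2)"
    by (simp add: mult_ac)
  moreover have "0 < 12 * (real (card (arcs G)))\<^sup>2"
    using arcs_nonempty by (simp add: card_gt_0_iff)
  ultimately show "total_length G len ^ 3 / (12 * (real (card (arcs G)))\<^sup>2) \<le> torsional_rigidity G len VD"
    by (simp only: pos_divide_le_eq)
qed

end

theorem mainTheorem7:
  fixes G :: "('v, 'e) pre_digraph" and len :: "'e \<Rightarrow> real" and VD :: "'v set"
  assumes "metric_graph G len"
    and "VD \<noteq> {}" and "VD \<subseteq> verts G"
  shows "total_length G len ^ 3 / (12 * (real (card (arcs G)))\<^sup>2) \<le> torsional_rigidity G len VD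
       \<and> torsional_rigidity G len VD \<le> total_length G len ^ 3 / 3"
  using metric_graph.torsional_rigidity_bounds[OF assms] by blast

end
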